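(* There exist universal constants $C_0, c, C > 0$ such that the following holds. Let $X \subset \mathbb{R}^m$ be a finite nonempty set with doubling constant $\lambda_X$, let $d \ge 1$ be an integer with $d \ge C_0 \log \lambda_X$, and let $G$ be a random projection from $\mathbb{R}^m$ to $\mathbb{R}^d$. Let $\mathcal{F}_m$ be an optimal solution of facility location with squared costs for $X$ in $\mathbb{R}^m$ and let $\mathcal{F}_d$ be an optimal solution of facility location with squared costs for the dataset $GX = \{Gx : x\in X\} \subset \mathbb{R}^d$. Then $$ c \cdot \mathrm{cost}(\mathcal{F}_m) \le \mathbb{E}[\mathrm{cost}(\mathcal{F}_d)] \le C \cdot \mathrm{cost}(\mathcal{F}_m),$$ where $\mathrm{cost}(\mathcal{F}_m)$ is evaluated for $X$, $\mathrm{cost}(\mathcal{F}_d)$ is evaluated for $GX$, and the expectation is over $G$.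
   Context: All norms are Euclidean. Facility location with squared costs: for a finite nonempty dataset $Y$ in a Euclidean space, a solution is a nonempty subset $\mathcal{F} \subseteq Y$, with cost $\mathrm{cost}(\mathcal{F}) = |\mathcal{F}| + \sum_{y \in Y} \min_{f \in \mathcal{F}} \|y - f\|^2$; an optimal solution minimizes this cost. Doubling constant: for $x \in X$, $r > 0$ let $B(x,r) = \{y \in X : \|x-y\| \le r\}$. The doubling constant $\lambda_X$ is the smallest $\lambda$ such that for all $x \in X$, $r > 0$ there is $S \subseteq X$ with $|S| \le \lambda$ and $B(x,r) \subseteq \bigcup_{s \in S} B(s, r/2)$. A random projection from $\mathbb{R}^m$ to $\mathbb{R}^d$ is a random linear map $G$ given by a $d \times m$ matrix with i.i.d. entries drawn from $\mathcal{N}(0, 1/d)$ (variance $1/d$). Almost surely $G$ is injective on $X$. *)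

theory Defs
  imports "HOL-Analysis.Analysis" "HOL-Probability.Probability"
begin

text \<open>
  The dimension has to vary inside the statement, since the constants are chosen before it.
  So a vector of n-dimensional space is a function on the naturals that vanishes from index n
  on, i.e. an element of \<^term>\<open>topspace (Euclidean_space n)\<close>, and every notion that depends on
  the norm takes n as an argument.
\<close>

definition edist :: "nat \<Rightarrow> (nat \<Rightarrow> real) \<Rightarrow> (nat \<Rightarrow> real) \<Rightarrow> real" where
  "edist n x y = L2_set (\<lambda>i. x i - y i) {..<n}"

definition ball_in :: "nat \<Rightarrow> (nat \<Rightarrow> real) set \<Rightarrow> (nat \<Rightarrow> real) \<Rightarrow> real \<Rightarrow> (nat \<Rightarrow> real) set" where
  "ball_in n X x r = {y \<in> X. edist n x y \<le> r}"

text \<open>For finite \<^term>\<open>X\<close> the least element exists: \<^term>\<open>S = X\<close> always covers.\<close>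

definition doubling_constant :: "nat \<Rightarrow> (nat \<Rightarrow> real) set \<Rightarrow> nat" where
  "doubling_constant n X =
     (LEAST k. \<forall>x\<in>X. \<forall>r>0. \<exists>S\<subseteq>X. finite S \<and> card S \<le> k \<and>
        ball_in n X x r \<subseteq> (\<Union>s\<in>S. ball_in n X s (r / 2)))"

definition fl_solution :: "(nat \<Rightarrow> real) set \<Rightarrow> (nat \<Rightarrow> real) set \<Rightarrow> bool" where
  "fl_solution Y F \<longleftrightarrow> F \<noteq> {} \<and> F \<subseteq> Y"

definition fl_cost :: "nat \<Rightarrow> (nat \<Rightarrow> real) set \<Rightarrow> (nat \<Rightarrow> real) set \<Rightarrow> real" where
  "fl_cost n Y F = real (card F) + (\<Sum>y\<in>Y. Min ((\<lambda>f. (edist n y f)\<^sup>2) ` F))"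

definition fl_optimal :: "nat \<Rightarrow> (nat \<Rightarrow> real) set \<Rightarrow> (nat \<Rightarrow> real) set \<Rightarrow> bool" where
  "fl_optimal n Y F \<longleftrightarrow>
     fl_solution Y F \<and> (\<forall>F'. fl_solution Y F' \<longrightarrow> fl_cost n Y F \<le> fl_cost n Y F')"

text \<open>
  The law of a d by m matrix with i.i.d. Gaussian entries of variance 1/d; the second parameter
  of \<^const>\<open>normal_density\<close> is the standard deviation.
\<close>

definition gaussian_matrix :: "nat \<Rightarrow> nat \<Rightarrow> (nat \<times> nat \<Rightarrow> real) measure" where
  "gaussian_matrix d m =
     PiM ({..<d} \<times> {..<m})
       (\<lambda>_. density lborel (\<lambda>x. ennreal (normal_density 0 (1 / sqrt (real d)) x)))"

definition mat_apply ::
    "nat \<Rightarrow> nat \<Rightarrow> (nat \<times> nat \<Rightarrow> real) \<Rightarrow> (nat \<Rightarrow> real) \<Rightarrow> (nat \<Rightarrow> real)" where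
  "mat_apply d m G x = (\<lambda>i. if i < d then \<Sum>j<m. G (i, j) * x j else 0)"

end

theory Submission
  imports Defs
begin

text \<open>
  Give each point \<open>p\<close> of \<open>X\<close> the radius \<open>r p\<close> at which the ball around it
  holds about \<open>1 / (r p)\<^sup>2\<close> points. Opening facilities greedily in order of increasing radius
  shows that the optimal cost is at most \<open>8 * (\<Sum>p\<in>X. (r p)\<^sup>2)\<close>. Conversely, suppose that the
  projection brings no point from outside the ball of radius \<open>r p\<close> to within \<open>r p / 2 ^ 11\<close>
  of the image of \<open>p\<close>. Then the projected ball of radius \<open>r p / 2 ^ 11\<close> is no more crowded than
  the original one, and the sum of \<open>(r p)\<^sup>2\<close> over all such \<open>p\<close> is at most a constant times the
  cost of any projected solution. Chaining over the coverings supplied by the doubling constant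
  shows that each \<open>p\<close> has this property with probability at least \<open>1 / 2\<close>. The upper bound
  projects an optimal solution and uses that squared distances are preserved in expectation.
\<close>

subsection \<open>Facility location and critical radii\<close>

text \<open>As \<open>r\<close> grows, \<open>r\<^sup>2\<close> times the number of points within
  \<open>r\<close> of \<open>p\<close> increases and crosses 1 either continuously or by a jump at
  one of the distances from \<open>p\<close>. The closed ball gives the value after the jump, the
  open ball the value before it.\<close>

lemma (in Metric_space) critical_radius_exists:
  assumes "finite X" "p \<in> X" "p \<in> M"
  obtains r where "0 < r" "1 \<le> r\<^sup>2 * real (card {q\<in>X. d p q \<le> r})"
    "r\<^sup>2 * real (card {q\<in>X. d p q < r}) \<le> 1"
proof -
  define B where "B q = {x\<in>X. d p x \<le> d p q}" for q
  \<comment> \<open>\<open>w q\<close> is the least squared radius that reaches \<open>q\<close> and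
    is at least the reciprocal of the size of \<open>B q\<close>. Its minimum over \<open>q\<close>
    is the squared critical radius.\<close>
  define w where "w q = max ((d p q)\<^sup>2) (1 / real (card (B q)))" for q
  have finB: "finite (B q)" for q
    using assms by (simp add: B_def)
  have card_B: "0 < card (B q)" if "q \<in> X" for q
    using that finB[of q] by (auto simp: B_def card_gt_0_iff)
  define q where "q = arg_min_on w X"
  have q: "q \<in> X" and w_min: "\<And>x. x \<in> X \<Longrightarrow> w q \<le> w x"
    using assms arg_min_if_finite(1)[of X w] arg_min_least[of X _ w] by (auto simp: q_def)
  define r where "r = sqrt (w q)"
  have "0 < w q"
    using card_B[OF q] by (simp add: w_def less_max_iff_disj)
  then have r: "0 < r" and r2: "r\<^sup>2 = w q"
    by (simp_all add: r_def)
  have "d p q \<le> r"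
    unfolding r_def by (rule real_le_rsqrt) (simp add: w_def)
  then have "card (B q) \<le> card {x\<in>X. d p x \<le> r}"
    using assms by (intro card_mono) (auto simp: B_def)
  then have "w q * card (B q) \<le> r\<^sup>2 * card {x\<in>X. d p x \<le> r}"
    unfolding r2 using \<open>0 < w q\<close> by (intro mult_left_mono) auto
  moreover have "1 / card (B q) * card (B q) \<le> w q * card (B q)"
    by (intro mult_right_mono) (auto simp: w_def)
  ultimately have 1: "1 \<le> r\<^sup>2 * real (card {x\<in>X. d p x \<le> r})"
    using card_B[OF q] by simp
  let ?U = "{x\<in>X. d p x < r}"
  have U: "finite ?U" "?U \<noteq> {}"
    using assms r by auto
  \<comment> \<open>\<open>q'\<close> is a farthest point of the open ball, so \<open>B q'\<close>
    is the whole open ball. Its squared distance is below \<open>r\<^sup>2\<close>, hence minimality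
    of \<open>w q\<close> bounds \<open>r\<^sup>2\<close> by the other entry of the maximum in
    \<open>w q'\<close>.\<close>
  define q' where "q' = arg_min_on (\<lambda>x. - d p x) ?U"
  have q': "q' \<in> ?U" and max: "\<And>x. x \<in> ?U \<Longrightarrow> d p x \<le> d p q'"
    using arg_min_if_finite(1)[OF U, of "\<lambda>x. - d p x"]
      arg_min_least[OF U, of _ "\<lambda>x. - d p x"] by (auto simp: q'_def)
  have "?U = B q'"
    using q' max by (auto simp: B_def)
  moreover have "(d p q')\<^sup>2 < r\<^sup>2"
    using q' by (intro power_strict_mono) auto
  then have "r\<^sup>2 \<le> 1 / card (B q')"
    using w_min[of q'] q' by (auto simp: r2 w_def[of q'])
  ultimately have "r\<^sup>2 * real (card ?U) \<le> 1"
    using card_B[of q'] q' by (simp add: B_def field_simps)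
  with r 1 show ?thesis
    using that by blast
qed

text \<open>Points are processed in order of increasing radius, and a point becomes a centre only if
  no earlier centre lies within twice its own radius. That radius is the largest so far, so the
  separation holds for both orders of a pair.\<close>

lemma (in Metric_space) greedy_centers:
  assumes "finite X" "X \<subseteq> M"
  obtains F where "F \<subseteq> X" "\<And>p. p \<in> X \<Longrightarrow> 0 < r p \<Longrightarrow> \<exists>f\<in>F. r f \<le> r p \<and> d p f \<le> 2 * r p"
    "\<And>f g. f \<in> F \<Longrightarrow> g \<in> F \<Longrightarrow> f \<noteq> g \<Longrightarrow> 2 * r f < d f g"
proof -
  have "X \<subseteq> M \<Longrightarrow> \<exists>F\<subseteq>X. (\<forall>p\<in>X. 0 < r p \<longrightarrow> (\<exists>f\<in>F. r f \<le> r p \<and> d p f \<le> 2 * r p)) \<and>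
    (\<forall>f\<in>F. \<forall>g\<in>F. f \<noteq> g \<longrightarrow> 2 * r f < d f g)"
    using assms(1)
  proof (induction X rule: finite_ranking_induct[where f = r])
    case empty
    then show ?case by auto
  next
    case (insert x S)
    then obtain F where F: "F \<subseteq> S" "\<forall>p\<in>S. 0 < r p \<longrightarrow> (\<exists>f\<in>F. r f \<le> r p \<and> d p f \<le> 2 * r p)"
      "\<forall>f\<in>F. \<forall>g\<in>F. f \<noteq> g \<longrightarrow> 2 * r f < d f g"
      by auto
    have le: "r f \<le> r x" if "f \<in> F" for f
      using that insert F by auto
    show ?case
    proof (cases "\<exists>f\<in>F. d x f \<le> 2 * r x")
      case True
      then show ?thesis
        using F le by (intro exI[of _ F]) auto
    next
      case False
      have "2 * r f < d f x" if "f \<in> F" for f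
        using False le[OF that] that commute[of f x] by force
      then show ?thesis
        using F False insert.prems by (intro exI[of _ "insert x F"]) (auto simp: not_le)
    qed
  qed
  then obtain F where "F \<subseteq> X" "\<forall>p\<in>X. 0 < r p \<longrightarrow> (\<exists>f\<in>F. r f \<le> r p \<and> d p f \<le> 2 * r p)"
    "\<forall>f\<in>F. \<forall>g\<in>F. f \<noteq> g \<longrightarrow> 2 * r f < d f g"
    using assms(2) by auto
  then show ?thesis
    by (intro that[of F]) auto
qed

text \<open>The greedy centres serve as facilities. Connecting \<open>x\<close> costs at most
  \<open>(2 * r x)\<^sup>2\<close>. The balls \<open>B f\<close> are disjoint, and inside
  \<open>B f\<close> radii are at least \<open>r f / 2\<close>, so the points of \<open>B f\<close>
  together pay for opening \<open>f\<close> with \<open>4 * (r q)\<^sup>2\<close> each.\<close>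

lemma (in Metric_space) facility_cost_le_sum_radii:
  assumes X: "finite X" "X \<noteq> {}" "X \<subseteq> M"
    and r_pos: "\<And>p. p \<in> X \<Longrightarrow> 0 < r p"
    and r_ball: "\<And>p. p \<in> X \<Longrightarrow> 1 \<le> (r p)\<^sup>2 * real (card {q\<in>X. d p q \<le> r p})"
  obtains F where "F \<subseteq> X" "F \<noteq> {}"
    "real (card F) + (\<Sum>x\<in>X. Min ((\<lambda>f. (d x f)\<^sup>2) ` F)) \<le> 8 * (\<Sum>p\<in>X. (r p)\<^sup>2)"
proof -
  obtain F where F: "F \<subseteq> X"
    and near: "\<And>p. p \<in> X \<Longrightarrow> \<exists>f\<in>F. r f \<le> r p \<and> d p f \<le> 2 * r p"
    and sep: "\<And>f g. f \<in> F \<Longrightarrow> g \<in> F \<Longrightarrow> f \<noteq> g \<Longrightarrow> 2 * r f < d f g"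
    using greedy_centers[OF X(1,3), of r] r_pos by metis
  have finF: "finite F" and FM: "F \<subseteq> M"
    using F X finite_subset by auto
  have ne: "F \<noteq> {}"
    using near X by blast
  define B where "B f = {q\<in>X. d f q \<le> r f}" for f
  have finB: "finite (B f)" for f
    using X by (simp add: B_def)
  \<comment> \<open>A much smaller radius at \<open>q\<close> would give \<open>q\<close> a nearby
    centre other than \<open>f\<close>, closer to \<open>f\<close> than the separation
    permits.\<close>
  have r_le: "r f \<le> 2 * r q" if "f \<in> F" "q \<in> B f" for f q
  proof -
    have q: "q \<in> X" "d f q \<le> r f"
      using that by (auto simp: B_def)
    obtain g where g: "g \<in> F" "r g \<le> r q" "d q g \<le> 2 * r q"
      using near q by blast
    show ?thesis
    proof (cases "f = g")
      case True
      then show ?thesis using g r_pos[OF q(1)] by simp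
    next
      case False
      have "2 * r f < d f g"
        using sep that g False by blast
      also have "\<dots> \<le> d f q + d q g"
        using triangle[of f q g] that g q FM X by blast
      finally show ?thesis using g q by linarith
    qed
  qed
  have "B f \<inter> B g = {}" if "f \<in> F" "g \<in> F" "f \<noteq> g" for f g
  proof (rule ccontr)
    assume "B f \<inter> B g \<noteq> {}"
    then obtain q where q: "q \<in> X" "d f q \<le> r f" "d g q \<le> r g"
      by (auto simp: B_def)
    have "d f g \<le> d f q + d q g"
      using triangle[of f q g] that q FM X by blast
    then show False
      using sep[OF that] sep[of g f] that q commute[of q g] commute[of f g] by simp
  qed
  then have disj: "pairwise (\<lambda>f g. disjnt (B f) (B g)) F"
    by (auto simp: pairwise_def disjnt_def)
  have "real (card F) = (\<Sum>f\<in>F. 1)"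
    by simp
  also have "\<dots> \<le> (\<Sum>f\<in>F. \<Sum>q\<in>B f. (r f)\<^sup>2)"
    using r_ball F by (intro sum_mono) (auto simp: B_def mult.commute)
  also have "\<dots> \<le> (\<Sum>f\<in>F. \<Sum>q\<in>B f. 4 * (r q)\<^sup>2)"
  proof (intro sum_mono)
    fix f q assume fq: "f \<in> F" "q \<in> B f"
    then have "(r f)\<^sup>2 \<le> (2 * r q)\<^sup>2"
      using r_pos F r_le[OF fq] by (intro power_mono) (auto intro: less_imp_le)
    then show "(r f)\<^sup>2 \<le> 4 * (r q)\<^sup>2"
      by (simp add: power_mult_distrib)
  qed
  also have "\<dots> = (\<Sum>q\<in>(\<Union>f\<in>F. B f). 4 * (r q)\<^sup>2)"
    using finF finB disj by (intro sum.UNION_disjoint[symmetric]) (auto simp: pairwise_def disjnt_def)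
  also have "\<dots> \<le> (\<Sum>q\<in>X. 4 * (r q)\<^sup>2)"
    using X by (intro sum_mono2) (auto simp: B_def)
  finally have 1: "real (card F) \<le> 4 * (\<Sum>p\<in>X. (r p)\<^sup>2)"
    by (simp add: sum_distrib_left)
  have "(\<Sum>x\<in>X. Min ((\<lambda>f. (d x f)\<^sup>2) ` F)) \<le> (\<Sum>x\<in>X. 4 * (r x)\<^sup>2)"
  proof (intro sum_mono)
    fix x assume "x \<in> X"
    then obtain f where f: "f \<in> F" "d x f \<le> 2 * r x"
      using near by blast
    have "Min ((\<lambda>f. (d x f)\<^sup>2) ` F) \<le> (d x f)\<^sup>2"
      using f finF by (intro Min_le) auto
    also have "\<dots> \<le> (2 * r x)\<^sup>2"
      using f by (intro power_mono) auto
    finally show "Min ((\<lambda>f. (d x f)\<^sup>2) ` F) \<le> 4 * (r x)\<^sup>2"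
      by (simp add: power_mult_distrib)
  qed
  with 1 have "real (card F) + (\<Sum>x\<in>X. Min ((\<lambda>f. (d x f)\<^sup>2) ` F)) \<le> 8 * (\<Sum>p\<in>X. (r p)\<^sup>2)"
    by (simp add: sum_distrib_left[symmetric])
  with F ne show ?thesis
    using that by blast
qed

text \<open>A point at distance at least \<open>r p / 2\<close> from the facilities pays for its own radius. All other
  points served by one facility lie in the ball around the one of largest radius, so together they
  pay at most its opening cost.\<close>

lemma (in Metric_space) sum_radii_le_facility_cost:
  assumes X: "finite X" "g ` X \<subseteq> M" and F: "finite F" "F \<noteq> {}" "F \<subseteq> M"
    and P: "P \<subseteq> X"
    and r_pos: "\<And>p. p \<in> P \<Longrightarrow> 0 < r p"
    and r_ball: "\<And>p. p \<in> P \<Longrightarrow> (r p)\<^sup>2 * real (card {q\<in>X. d (g p) (g q) < r p}) \<le> 1"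
  shows "(\<Sum>p\<in>P. (r p)\<^sup>2) \<le> real (card F) + 4 * (\<Sum>x\<in>X. Min ((\<lambda>f. (d (g x) f)\<^sup>2) ` F))"
proof -
  define \<nu> where "\<nu> x = arg_min_on (\<lambda>f. d (g x) f) F" for x
  have \<nu>: "\<nu> x \<in> F" for x
    using arg_min_if_finite(1)[OF F(1,2)] by (simp add: \<nu>_def)
  have \<nu>_min: "Min ((\<lambda>f. (d (g x) f)\<^sup>2) ` F) = (d (g x) (\<nu> x))\<^sup>2" for x
  proof (rule Min_eqI)
    fix y assume "y \<in> (\<lambda>f. (d (g x) f)\<^sup>2) ` F"
    then obtain f where f: "f \<in> F" "y = (d (g x) f)\<^sup>2"
      by blast
    have "d (g x) (\<nu> x) \<le> d (g x) f"
      using arg_min_least[OF F(1,2) f(1), of "d (g x)"] by (simp add: \<nu>_def)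
    then show "(d (g x) (\<nu> x))\<^sup>2 \<le> y"
      unfolding f by (intro power_mono) auto
  qed (use \<nu> F in auto)
  define N where "N = {p\<in>P. 2 * d (g p) (\<nu> p) < r p}"
  have finP: "finite P"
    using P X finite_subset by blast
  then have finN: "finite N"
    by (simp add: N_def)
  have cluster: "(\<Sum>p | p \<in> N \<and> \<nu> p = f. (r p)\<^sup>2) \<le> 1" if "f \<in> F" for f
  proof (cases "{p\<in>N. \<nu> p = f} = {}")
    case True
    then show ?thesis by (metis sum.empty zero_le_one)
  next
    case False
    let ?C = "{p\<in>N. \<nu> p = f}"
    have finC: "finite ?C"
      using finN by simp
    define p where "p = arg_min_on (\<lambda>p. - r p) ?C"
    have p: "p \<in> ?C" and p_max: "\<And>q. q \<in> ?C \<Longrightarrow> r q \<le> r p"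
      using arg_min_if_finite(1)[OF finC False, of "\<lambda>p. - r p"]
        arg_min_least[OF finC False, of _ "\<lambda>p. - r p"] by (auto simp: p_def)
    have "?C \<subseteq> {q\<in>X. d (g p) (g q) < r p}"
    proof
      fix q assume q: "q \<in> ?C"
      have "d (g p) (g q) \<le> d (g p) f + d f (g q)"
        using triangle[of "g p" f "g q"] p q that F X P by (auto simp: N_def)
      moreover have "2 * d (g p) f < r p" "2 * d (g q) f < r q" "r q \<le> r p"
        using p q p_max by (auto simp: N_def)
      ultimately show "q \<in> {q\<in>X. d (g p) (g q) < r p}"
        using q P commute[of f "g q"] by (auto simp: N_def)
    qed
    then have "card ?C \<le> card {q\<in>X. d (g p) (g q) < r p}"
      using X by (intro card_mono) auto
    have "(\<Sum>q\<in>?C. (r q)\<^sup>2) \<le> (\<Sum>q\<in>?C. (r p)\<^sup>2)"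
      using p_max r_pos by (intro sum_mono power_mono) (auto simp: N_def intro: less_imp_le)
    also have "\<dots> = (r p)\<^sup>2 * card ?C"
      by simp
    also have "\<dots> \<le> (r p)\<^sup>2 * card {q\<in>X. d (g p) (g q) < r p}"
      using \<open>card ?C \<le> _\<close> by (intro mult_left_mono) auto
    also have "\<dots> \<le> 1"
      using r_ball p by (auto simp: N_def)
    finally show ?thesis by simp
  qed
  have "(\<Sum>p\<in>N. (r p)\<^sup>2) = (\<Sum>f\<in>F. \<Sum>p | p \<in> N \<and> \<nu> p = f. (r p)\<^sup>2)"
    using \<nu> by (intro sum.group[symmetric] finN F) auto
  also have "\<dots> \<le> (\<Sum>f\<in>F. 1)"
    by (intro sum_mono cluster)
  finally have 1: "(\<Sum>p\<in>N. (r p)\<^sup>2) \<le> real (card F)"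
    by simp
  have "(\<Sum>p\<in>P - N. (r p)\<^sup>2) \<le> (\<Sum>p\<in>P - N. 4 * (d (g p) (\<nu> p))\<^sup>2)"
  proof (rule sum_mono)
    fix p assume "p \<in> P - N"
    then have "(r p)\<^sup>2 \<le> (2 * d (g p) (\<nu> p))\<^sup>2"
      using r_pos by (intro power_mono) (auto simp: N_def intro: less_imp_le)
    then show "(r p)\<^sup>2 \<le> 4 * (d (g p) (\<nu> p))\<^sup>2"
      by (simp add: power_mult_distrib)
  qed
  also have "\<dots> \<le> (\<Sum>p\<in>X. 4 * (d (g p) (\<nu> p))\<^sup>2)"
    using X P by (intro sum_mono2) auto
  finally have 2: "(\<Sum>p\<in>P - N. (r p)\<^sup>2) \<le> 4 * (\<Sum>p\<in>X. (d (g p) (\<nu> p))\<^sup>2)"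
    by (simp add: sum_distrib_left)
  have "(\<Sum>p\<in>P. (r p)\<^sup>2) = (\<Sum>p\<in>P - N. (r p)\<^sup>2) + (\<Sum>p\<in>N. (r p)\<^sup>2)"
    using finP by (intro sum.subset_diff) (auto simp: N_def)
  then show ?thesis
    using 1 2 by (simp add: \<nu>_min)
qed

subsection \<open>Euclidean distances and linear maps\<close>

lemma Metric_space_edist: "Metric_space (topspace (Euclidean_space n)) (edist n)"
proof
  fix x y z
  show "0 \<le> edist n x y"
    by (simp add: edist_def)
  show "edist n x y = edist n y x"
    by (simp add: edist_def L2_set_def power2_commute)
  show "edist n x y = 0 \<longleftrightarrow> x = y"
    if "x \<in> topspace (Euclidean_space n)" "y \<in> topspace (Euclidean_space n)"
  proof
    assume "edist n x y = 0"
    then have "x i = y i" if "i < n" for i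
      using that by (simp add: edist_def L2_set_eq_0_iff)
    moreover have "x i = y i" if "i \<ge> n" for i
      using that \<open>x \<in> _\<close> \<open>y \<in> _\<close> by (simp add: topspace_Euclidean_space)
    ultimately show "x = y"
      by (meson ext not_le)
  qed (simp add: edist_def L2_set_0')
  show "edist n x z \<le> edist n x y + edist n y z"
    using L2_set_triangle_ineq[of "\<lambda>i. x i - y i" "\<lambda>i. y i - z i" "{..<n}"]
    by (simp add: edist_def)
qed

lemma mat_apply_in_Euclidean_space [simp]: "mat_apply d m G x \<in> topspace (Euclidean_space d)"
  by (simp add: topspace_Euclidean_space mat_apply_def)

text \<open>By linearity, distances between images become lengths of the image of one fixed vector,
  the quantity that the Gaussian estimates control.\<close>

lemma edist_mat_apply:
  "edist d (mat_apply d m G x) (mat_apply d m G y) = L2_set (mat_apply d m G (\<lambda>j. x j - y j)) {..<d}"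
  unfolding edist_def
  by (intro L2_set_cong) (auto simp: mat_apply_def right_diff_distrib sum_subtractf)

subsection \<open>Doubling constant\<close>

lemma ball_in_self: "x \<in> X \<Longrightarrow> 0 \<le> r \<Longrightarrow> x \<in> ball_in n X x r"
  by (simp add: ball_in_def edist_def L2_set_0')

lemma doubling_constant_cover:
  assumes "finite X" "x \<in> X" "0 < r"
  shows "\<exists>S\<subseteq>X. card S \<le> doubling_constant n X \<and>
    ball_in n X x r \<subseteq> (\<Union>s\<in>S. ball_in n X s (r / 2))"
proof -
  let ?P = "\<lambda>k. \<forall>x\<in>X. \<forall>r>0. \<exists>S\<subseteq>X. finite S \<and> card S \<le> k \<and>
        ball_in n X x r \<subseteq> (\<Union>s\<in>S. ball_in n X s (r / 2))"
  have "?P (card X)"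
  proof (intro ballI allI impI exI[of _ X] conjI subset_refl)
    fix x r assume "x \<in> X" "0 < (r::real)"
    have "y \<in> ball_in n X y (r / 2)" if "y \<in> X" for y
      using that \<open>0 < r\<close> by (simp add: ball_in_self)
    then show "ball_in n X x r \<subseteq> (\<Union>s\<in>X. ball_in n X s (r / 2))"
      by (auto simp: ball_in_def)
  qed (use assms in auto)
  then have "?P (doubling_constant n X)"
    unfolding doubling_constant_def by (rule LeastI)
  from this[rule_format, OF assms(2,3)] show ?thesis
    by blast
qed

lemma doubling_constant_pos:
  assumes "finite X" "X \<noteq> {}"
  shows "1 \<le> doubling_constant n X"
proof -
  obtain x where x: "x \<in> X"
    using assms by blast
  obtain S where S: "S \<subseteq> X" "card S \<le> doubling_constant n X"
    "ball_in n X x 1 \<subseteq> (\<Union>s\<in>S. ball_in n X s (1 / 2))"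
    using doubling_constant_cover[OF assms(1) x, of 1 n] by auto
  have "x \<in> ball_in n X x 1"
    using x by (simp add: ball_in_self)
  then have "0 < card S"
    using S assms finite_subset by (fastforce simp: card_gt_0_iff)
  then show ?thesis
    using S by linarith
qed

lemma doubling_constant_iterated_cover:
  assumes "finite X" "x \<in> X" "0 < r"
  shows "\<exists>S\<subseteq>X. card S \<le> doubling_constant n X ^ k \<and>
    ball_in n X x r \<subseteq> (\<Union>s\<in>S. ball_in n X s (r / 2 ^ k))"
proof (induction k)
  case 0
  show ?case
    using assms by (intro exI[of _ "{x}"]) auto
next
  case (Suc k)
  then obtain S where S: "S \<subseteq> X" "card S \<le> doubling_constant n X ^ k"
    "ball_in n X x r \<subseteq> (\<Union>s\<in>S. ball_in n X s (r / 2 ^ k))"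
    by blast
  have "\<forall>s\<in>S. \<exists>T\<subseteq>X. card T \<le> doubling_constant n X \<and>
    ball_in n X s (r / 2 ^ k) \<subseteq> (\<Union>t\<in>T. ball_in n X t (r / 2 ^ k / 2))"
    using doubling_constant_cover[OF assms(1)] S(1) assms(3) by (meson divide_pos_pos subsetD zero_less_numeral zero_less_power)
  then obtain T where T: "\<And>s. s \<in> S \<Longrightarrow> T s \<subseteq> X" "\<And>s. s \<in> S \<Longrightarrow> card (T s) \<le> doubling_constant n X"
    "\<And>s. s \<in> S \<Longrightarrow> ball_in n X s (r / 2 ^ k) \<subseteq> (\<Union>t\<in>T s. ball_in n X t (r / 2 ^ k / 2))"
    by metis
  have finS: "finite S"
    using S assms finite_subset by blast
  have "card (\<Union>s\<in>S. T s) \<le> (\<Sum>s\<in>S. card (T s))"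
    by (rule card_UN_le[OF finS])
  also have "\<dots> \<le> card S * doubling_constant n X"
    using sum_bounded_above[of S "\<lambda>s. card (T s)"] T(2) by simp
  also have "\<dots> \<le> doubling_constant n X ^ Suc k"
    using S(2) by simp
  finally have "card (\<Union>s\<in>S. T s) \<le> doubling_constant n X ^ Suc k" .
  moreover have "ball_in n X x r \<subseteq> (\<Union>t\<in>(\<Union>s\<in>S. T s). ball_in n X t (r / 2 ^ Suc k))"
    using S(3) T(3) by (fastforce simp: mult.commute)
  ultimately show ?case
    using T(1) by (intro exI[of _ "\<Union>s\<in>S. T s"]) blast
qed

subsection \<open>Gaussian random projections\<close>

lemma prob_space_normal_law:
  assumes "0 < \<sigma>"
  shows "prob_space (density lborel (\<lambda>x. ennreal (normal_density \<mu> \<sigma> x)))"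
  using prob_space_normal_density[OF assms] .

lemma prob_space_gaussian_matrix:
  assumes "1 \<le> d"
  shows "prob_space (gaussian_matrix d m)"
  unfolding gaussian_matrix_def
  using assms by (intro prob_space_PiM prob_space_normal_law) auto

lemma measurable_gaussian_matrix_entry:
  assumes "i < d" "j < m"
  shows "(\<lambda>G. G (i, j)) \<in> borel_measurable (gaussian_matrix d m)"
proof -
  have "(\<lambda>G. G (i, j)) \<in> measurable (gaussian_matrix d m)
    (density lborel (\<lambda>x. ennreal (normal_density 0 (1 / sqrt (real d)) x)))"
    unfolding gaussian_matrix_def using assms by (intro measurable_component_singleton) auto
  then show ?thesis
    by simp
qed

lemma measurable_mat_apply [measurable]:
  "(\<lambda>G. mat_apply d m G x i) \<in> borel_measurable (gaussian_matrix d m)"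
  unfolding mat_apply_def
  by (cases "i < d") (auto intro!: borel_measurable_sum borel_measurable_times measurable_gaussian_matrix_entry)

lemma measurable_edist_mat_apply [measurable]:
  "(\<lambda>G. edist d (mat_apply d m G x) (mat_apply d m G y)) \<in> borel_measurable (gaussian_matrix d m)"
  unfolding edist_def L2_set_def by measurable

lemma distributed_gaussian_matrix_entry:
  assumes "i < d" "j < m"
  shows "distributed (gaussian_matrix d m) lborel (\<lambda>G. G (i, j)) (normal_density 0 (1 / sqrt (real d)))"
proof -
  let ?N = "density lborel (\<lambda>x. ennreal (normal_density 0 (1 / sqrt (real d)) x))"
  have "distr (gaussian_matrix d m) ?N (\<lambda>G. G (i, j)) = ?N"
    unfolding gaussian_matrix_def
    using assms by (intro distr_PiM_component prob_space_normal_law) auto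
  then have "distr (gaussian_matrix d m) lborel (\<lambda>G. G (i, j)) = ?N"
    by (subst distr_cong[where g = "\<lambda>G. G (i, j)" and L = ?N]) auto
  then show ?thesis
    using measurable_gaussian_matrix_entry[OF assms] by (simp add: distributed_def)
qed

text \<open>Independence is read off the joint law: the tuple of all entries is the identity map on
  the product space, so its law is the product of the marginals.\<close>

lemma indep_vars_gaussian_matrix_entries:
  assumes "1 \<le> d" "0 < m"
  shows "prob_space.indep_vars (gaussian_matrix d m)
    (\<lambda>_. density lborel (\<lambda>x. ennreal (normal_density 0 (1 / sqrt (real d)) x)))
    (\<lambda>ij G. G ij) ({..<d} \<times> {..<m})"
proof -
  let ?N = "density lborel (\<lambda>x. ennreal (normal_density 0 (1 / sqrt (real d)) x))"
  let ?I = "{..<d} \<times> {..<m}"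
  interpret prob_space "gaussian_matrix d m"
    by (rule prob_space_gaussian_matrix[OF assms(1)])
  have ne: "?I \<noteq> {}"
    using assms by (auto simp: lessThan_empty_iff)
  have comp: "(\<lambda>G. G ij) \<in> measurable (gaussian_matrix d m) ?N" if "ij \<in> ?I" for ij
    unfolding gaussian_matrix_def using that by (rule measurable_component_singleton)
  have "distr (gaussian_matrix d m) (PiM ?I (\<lambda>_. ?N)) (\<lambda>G. \<lambda>ij\<in>?I. G ij) =
    distr (gaussian_matrix d m) (gaussian_matrix d m) (\<lambda>G. G)"
    by (intro distr_cong) (auto simp: gaussian_matrix_def space_PiM PiE_def extensional_restrict)
  also have "\<dots> = gaussian_matrix d m"
    by simp
  also have "\<dots> = PiM ?I (\<lambda>ij. distr (gaussian_matrix d m) ?N (\<lambda>G. G ij))"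
    unfolding gaussian_matrix_def
    using assms by (intro PiM_cong refl distr_PiM_component[symmetric] prob_space_normal_law) auto
  finally show ?thesis
    by (subst indep_vars_iff_distr_eq_PiM'[OF ne comp]) auto
qed

text \<open>A coordinate of the image is a linear combination of independent normal entries, whose
  variances \<open>(v j)\<^sup>2 / d\<close> add up.\<close>

lemma distributed_mat_apply:
  assumes "i < d" and v: "0 < L2_set v {..<m}"
  shows "distributed (gaussian_matrix d m) lborel (\<lambda>G. mat_apply d m G v i)
    (normal_density 0 (L2_set v {..<m} / sqrt (real d)))"
proof -
  let ?N = "density lborel (\<lambda>x. ennreal (normal_density 0 (1 / sqrt (real d)) x))"
  \<comment> \<open>Coordinates where \<open>v\<close> vanishes are left out: their terms are
    constant and have no density, while \<open>sum_indep_normal\<close> asks for positive standard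
    deviations.\<close>
  define J where "J = {j. j < m \<and> v j \<noteq> 0}"
  have d: "1 \<le> d"
    using assms by simp
  have J: "finite J" "J \<subseteq> {..<m}"
    by (auto simp: J_def)
  have ne: "J \<noteq> {}"
    using v L2_set_0'[of "{..<m}" v] by (auto simp: J_def)
  then have m: "0 < m"
    by (auto simp: J_def)
  interpret prob_space "gaussian_matrix d m"
    by (rule prob_space_gaussian_matrix[OF d])
  \<comment> \<open>Restricting to the singletons \<open>{(i, j)}\<close> turns the family indexed
    by pairs into one indexed by \<open>j\<close>. The summand 0 below matches the affine form in
    \<open>normal_density_affine\<close>.\<close>
  have "indep_vars (\<lambda>j. PiM {(i, j)} (\<lambda>_. ?N)) (\<lambda>j G. restrict (\<lambda>ij. G ij) {(i, j)}) J"
    by (rule indep_vars_restrict[OF indep_vars_gaussian_matrix_entries[OF d m]])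
      (use J assms in \<open>auto simp: disjoint_family_on_def\<close>)
  then have "indep_vars (\<lambda>_. borel) (\<lambda>j G. 0 + v j * restrict (\<lambda>ij. G ij) {(i, j)} (i, j)) J"
  proof (rule indep_vars_compose2)
    fix j :: nat
    have "(\<lambda>\<omega>. \<omega> (i, j)) \<in> measurable (PiM {(i, j)} (\<lambda>_. ?N)) ?N"
      by (intro measurable_component_singleton) auto
    then show "(\<lambda>\<omega>. 0 + v j * \<omega> (i, j)) \<in> borel_measurable (PiM {(i, j)} (\<lambda>_. ?N))"
      by (intro borel_measurable_add borel_measurable_times) auto
  qed
  then have indep: "indep_vars (\<lambda>_. borel) (\<lambda>j G. 0 + v j * G (i, j)) J"
    by simp
  have "distributed (gaussian_matrix d m) lborel (\<lambda>G. 0 + v j * G (i, j))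
      (normal_density (0 + v j * 0) (\<bar>v j\<bar> * (1 / sqrt (real d))))" if "j \<in> J" for j
    using that assms by (intro normal_density_affine distributed_gaussian_matrix_entry) (auto simp: J_def)
  then have "distributed (gaussian_matrix d m) lborel (\<lambda>G. \<Sum>j\<in>J. 0 + v j * G (i, j))
    (normal_density (\<Sum>j\<in>J. 0) (sqrt (\<Sum>j\<in>J. (\<bar>v j\<bar> * (1 / sqrt (real d)))\<^sup>2)))"
    using d by (intro sum_indep_normal J ne indep) (auto simp: J_def)
  moreover have "(\<Sum>j\<in>J. 0 + v j * G (i, j)) = mat_apply d m G v i" for G
    using assms J by (simp add: mat_apply_def J_def) (rule sum.mono_neutral_cong_left, auto)
  moreover have "(\<Sum>j\<in>J. (\<bar>v j\<bar> * (1 / sqrt (real d)))\<^sup>2) = (\<Sum>j<m. (v j)\<^sup>2) / d"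
    using J d unfolding sum_divide_distrib
    by (intro sum.mono_neutral_cong_left) (auto simp: power_mult_distrib power_divide J_def)
  ultimately show ?thesis
    by (simp add: L2_set_def real_sqrt_divide)
qed

text \<open>Different coordinates of the image use different rows, i.e. disjoint blocks of
  independent entries.\<close>

lemma indep_vars_mat_apply:
  assumes "1 \<le> d" "0 < m"
  shows "prob_space.indep_vars (gaussian_matrix d m) (\<lambda>_. borel) (\<lambda>i G. mat_apply d m G v i) {..<d}"
proof -
  let ?N = "density lborel (\<lambda>x. ennreal (normal_density 0 (1 / sqrt (real d)) x))"
  interpret prob_space "gaussian_matrix d m"
    by (rule prob_space_gaussian_matrix[OF assms(1)])
  have "indep_vars (\<lambda>i. PiM ({i} \<times> {..<m}) (\<lambda>_. ?N)) (\<lambda>i G. restrict (\<lambda>ij. G ij) ({i} \<times> {..<m})) {..<d}"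
    by (rule indep_vars_restrict[OF indep_vars_gaussian_matrix_entries[OF assms]])
      (auto simp: disjoint_family_on_def)
  then have "indep_vars (\<lambda>_. borel)
      (\<lambda>i G. \<Sum>j<m. restrict (\<lambda>ij. G ij) ({i} \<times> {..<m}) (i, j) * v j) {..<d}"
  proof (rule indep_vars_compose2)
    fix i :: nat
    have "(\<lambda>\<omega>. \<omega> (i, j)) \<in> borel_measurable (PiM ({i} \<times> {..<m}) (\<lambda>_. ?N))" if "j < m" for j
    proof -
      have "(\<lambda>\<omega>. \<omega> (i, j)) \<in> measurable (PiM ({i} \<times> {..<m}) (\<lambda>_. ?N)) ?N"
        using that by (intro measurable_component_singleton) auto
      then show ?thesis by simp
    qed
    then show "(\<lambda>\<omega>. \<Sum>j<m. \<omega> (i, j) * v j) \<in> borel_measurable (PiM ({i} \<times> {..<m}) (\<lambda>_. ?N))"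
      by (intro borel_measurable_sum borel_measurable_times) auto
  qed
  then show ?thesis
    by (rule indep_vars_cong[THEN iffD1, rotated -1]) (auto simp: mat_apply_def fun_eq_iff)
qed

section \<open>Laplace transform, tail bounds and second moment of the projected length\<close>

lemma nn_integral_exp_square_normal:
  assumes \<sigma>: "0 < \<sigma>" and t: "0 < 1 + 2 * t * \<sigma>\<^sup>2"
  shows "(\<integral>\<^sup>+x. ennreal (normal_density 0 \<sigma> x) * ennreal (exp (- t * x\<^sup>2)) \<partial>lborel)
    = ennreal (1 / sqrt (1 + 2 * t * \<sigma>\<^sup>2))"
proof -
  \<comment> \<open>Tilting the normal density by \<open>exp (- t * x\<^sup>2)\<close> gives a
    multiple of the normal density with standard deviation \<open>\<tau>\<close>. The upper tail
    uses this with negative \<open>t\<close>.\<close>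
  define \<tau> where "\<tau> = \<sigma> / sqrt (1 + 2 * t * \<sigma>\<^sup>2)"
  have \<tau>: "0 < \<tau>" and \<tau>2: "\<tau>\<^sup>2 = \<sigma>\<^sup>2 / (1 + 2 * t * \<sigma>\<^sup>2)"
    using assms by (simp_all add: \<tau>_def power_divide)
  have "normal_density 0 \<sigma> x * exp (- t * x\<^sup>2) = \<tau> / \<sigma> * normal_density 0 \<tau> x" for x
  proof -
    have "- x\<^sup>2 / (2 * \<sigma>\<^sup>2) + - t * x\<^sup>2 = - x\<^sup>2 / (2 * \<tau>\<^sup>2)"
      using assms by (simp add: \<tau>2 field_simps)
    then have "exp (- x\<^sup>2 / (2 * \<sigma>\<^sup>2)) * exp (- t * x\<^sup>2) = exp (- x\<^sup>2 / (2 * \<tau>\<^sup>2))"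
      by (simp add: exp_add[symmetric])
    then show ?thesis
      using \<sigma> \<tau> by (simp add: normal_density_def real_sqrt_mult)
  qed
  then have "(\<integral>\<^sup>+x. ennreal (normal_density 0 \<sigma> x) * ennreal (exp (- t * x\<^sup>2)) \<partial>lborel)
    = (\<integral>\<^sup>+x. ennreal (\<tau> / \<sigma>) * ennreal (normal_density 0 \<tau> x) \<partial>lborel)"
    using \<sigma> \<tau> by (intro nn_integral_cong) (simp add: ennreal_mult'[symmetric])
  also have "\<dots> = ennreal (\<tau> / \<sigma>) * (\<integral>\<^sup>+x. ennreal (normal_density 0 \<tau> x) \<partial>lborel)"
    by (intro nn_integral_cmult) simp
  also have "(\<integral>\<^sup>+x. ennreal (normal_density 0 \<tau> x) \<partial>lborel) = 1"
    using \<tau> by (simp add: nn_integral_eq_integral)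
  finally show ?thesis
    using \<sigma> by (simp add: \<tau>_def)
qed

text \<open>The coordinates are independent with a common law, so the transform of the squared
  length is the \<open>d\<close>-th power of that of one coordinate. \<open>s\<close> is
  \<open>t\<close> times the variance of a coordinate.\<close>

lemma nn_integral_exp_L2_set_mat_apply:
  assumes v: "0 < L2_set v {..<m}" and d: "1 \<le> d"
    and t: "t * (L2_set v {..<m})\<^sup>2 = real d * s" and s: "0 < 1 + 2 * s"
  shows "(\<integral>\<^sup>+G. ennreal (exp (- t * (L2_set (mat_apply d m G v) {..<d})\<^sup>2)) \<partial>gaussian_matrix d m)
    = ennreal ((1 / sqrt (1 + 2 * s)) ^ d)"
proof -
  define \<sigma> where "\<sigma> = L2_set v {..<m} / sqrt (real d)"
  interpret prob_space "gaussian_matrix d m"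
    by (rule prob_space_gaussian_matrix[OF d])
  have m: "0 < m"
    using v by (cases "m = 0") auto
  have \<sigma>: "0 < \<sigma>" "t * \<sigma>\<^sup>2 = s"
    using v d t by (auto simp: \<sigma>_def field_simps)
  have coord: "(\<integral>\<^sup>+G. ennreal (exp (- t * (mat_apply d m G v i)\<^sup>2)) \<partial>gaussian_matrix d m)
      = ennreal (1 / sqrt (1 + 2 * s))" if "i < d" for i
  proof -
    have "distributed (gaussian_matrix d m) lborel (\<lambda>G. mat_apply d m G v i) (normal_density 0 \<sigma>)"
      using distributed_mat_apply[OF that v] by (simp add: \<sigma>_def)
    from distributed_nn_integral[OF this, of "\<lambda>x. ennreal (exp (- t * x\<^sup>2))"]
    show ?thesis
      using nn_integral_exp_square_normal[of \<sigma> t] \<sigma> s by (simp add: mult.assoc)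
  qed
  have "indep_vars (\<lambda>_. borel) (\<lambda>i G. ennreal (exp (- t * (mat_apply d m G v i)\<^sup>2))) {..<d}"
    by (rule indep_vars_compose2[OF indep_vars_mat_apply[OF d m]]) measurable
  then have "(\<integral>\<^sup>+G. (\<Prod>i<d. ennreal (exp (- t * (mat_apply d m G v i)\<^sup>2))) \<partial>gaussian_matrix d m)
    = (\<Prod>i<d. \<integral>\<^sup>+G. ennreal (exp (- t * (mat_apply d m G v i)\<^sup>2)) \<partial>gaussian_matrix d m)"
    by (intro indep_vars_nn_integral) auto
  also have "\<dots> = (\<Prod>i<d. ennreal (1 / sqrt (1 + 2 * s)))"
    by (intro prod.cong refl coord) simp
  finally have "(\<integral>\<^sup>+G. (\<Prod>i<d. ennreal (exp (- t * (mat_apply d m G v i)\<^sup>2))) \<partial>gaussian_matrix d m)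
    = (\<Prod>i<d. ennreal (1 / sqrt (1 + 2 * s)))" .
  moreover have "(\<Prod>i<d. ennreal (exp (- t * (mat_apply d m G v i)\<^sup>2)))
      = ennreal (exp (- t * (L2_set (mat_apply d m G v) {..<d})\<^sup>2))" for G
    by (simp add: prod_ennreal exp_sum[symmetric] L2_set_def sum_nonneg sum_distrib_left)
  ultimately show ?thesis
    using s by (simp add: ennreal_power)
qed

text \<open>A Chernoff bound. The power \<open>d\<close> lets it beat nets whose size is exponential
  in \<open>d\<close>.\<close>

lemma gaussian_matrix_lower_tail:
  assumes v: "0 < L2_set v {..<m}" and d: "1 \<le> d" and \<epsilon>: "0 < \<epsilon>"
  shows "measure (gaussian_matrix d m)
    {G\<in>space (gaussian_matrix d m). L2_set (mat_apply d m G v) {..<d} \<le> \<epsilon> * L2_set v {..<m}}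
    \<le> (3 * \<epsilon>) ^ d"
proof -
  interpret prob_space "gaussian_matrix d m"
    by (rule prob_space_gaussian_matrix[OF d])
  let ?l = "L2_set v {..<m}"
  let ?A = "{G\<in>space (gaussian_matrix d m). L2_set (mat_apply d m G v) {..<d} \<le> \<epsilon> * ?l}"
  \<comment> \<open>This choice makes the Chernoff prefactor \<open>exp 1 ^ d\<close> and gives
    \<open>s = 1 / \<epsilon>\<^sup>2\<close>, so each coordinate contributes at most
    \<open>exp 1 * \<epsilon>\<close>.\<close>
  define t where "t = real d / (\<epsilon> * ?l)\<^sup>2"
  have t: "0 < t"
    using assms by (simp add: t_def)
  have [measurable]: "(\<lambda>G. L2_set (mat_apply d m G v) {..<d}) \<in> borel_measurable (gaussian_matrix d m)"
    unfolding L2_set_def by measurable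
  have "emeasure (gaussian_matrix d m) ?A
    \<le> emeasure (gaussian_matrix d m) {G\<in>space (gaussian_matrix d m). (L2_set (mat_apply d m G v) {..<d})\<^sup>2 \<le> (\<epsilon> * ?l)\<^sup>2}"
    by (intro emeasure_mono) (auto intro!: power_mono)
  also have "\<dots> \<le> ennreal (exp (t * (\<epsilon> * ?l)\<^sup>2)) *
    (\<integral>\<^sup>+G. ennreal (exp (- t * (L2_set (mat_apply d m G v) {..<d})\<^sup>2)) * indicator (space (gaussian_matrix d m)) G \<partial>gaussian_matrix d m)"
    by (rule Chernoff_ineq_nn_integral_le[OF t]) measurable
  also have "(\<integral>\<^sup>+G. ennreal (exp (- t * (L2_set (mat_apply d m G v) {..<d})\<^sup>2)) * indicator (space (gaussian_matrix d m)) G \<partial>gaussian_matrix d m)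
     = (\<integral>\<^sup>+G. ennreal (exp (- t * (L2_set (mat_apply d m G v) {..<d})\<^sup>2)) \<partial>gaussian_matrix d m)"
    by (intro nn_integral_cong) simp
  also have "\<dots> = ennreal ((1 / sqrt (1 + 2 * (1 / \<epsilon>\<^sup>2))) ^ d)"
    using assms by (intro nn_integral_exp_L2_set_mat_apply) (auto simp: t_def power_mult_distrib add_pos_nonneg)
  also have "exp (t * (\<epsilon> * ?l)\<^sup>2) = exp 1 ^ d"
    using assms by (simp add: t_def exp_of_nat_mult[symmetric])
  also have "ennreal (exp 1 ^ d) * ennreal ((1 / sqrt (1 + 2 * (1 / \<epsilon>\<^sup>2))) ^ d)
    = ennreal ((exp 1 * (1 / sqrt (1 + 2 * (1 / \<epsilon>\<^sup>2)))) ^ d)"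
    by (simp add: ennreal_mult'[symmetric] power_mult_distrib power_divide)
  also have "\<dots> \<le> ennreal ((3 * \<epsilon>) ^ d)"
  proof (intro ennreal_leI power_mono mult_mono)
    define y where "y = 1 / \<epsilon>\<^sup>2"
    have "0 \<le> y" "sqrt y = 1 / \<epsilon>"
      using \<epsilon> by (simp_all add: y_def real_sqrt_divide)
    then have "1 / \<epsilon> \<le> sqrt (1 + 2 * y)"
      by (metis add_increasing le_add_same_cancel1 mult_2 real_sqrt_le_mono zero_le_one)
    then have "inverse (sqrt (1 + 2 * y)) \<le> inverse (1 / \<epsilon>)"
      using \<epsilon> by (intro le_imp_inverse_le) auto
    then show "1 / sqrt (1 + 2 * (1 / \<epsilon>\<^sup>2)) \<le> \<epsilon>"
      by (simp add: y_def inverse_eq_divide)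
  qed (use \<epsilon> exp_le in auto)
  finally show ?thesis
    using \<epsilon> by (simp add: emeasure_eq_measure)
qed

text \<open>\<open>l\<close> is only an upper bound for the length of \<open>v\<close>, as for the
  links of a chain, where \<open>v\<close> may be zero. That case is treated first, since its image
  has no density.\<close>

lemma gaussian_matrix_upper_tail:
  assumes v: "L2_set v {..<m} \<le> l" "0 < l" and d: "1 \<le> d" and u: "0 \<le> u"
  shows "measure (gaussian_matrix d m)
    {G\<in>space (gaussian_matrix d m). u * l < L2_set (mat_apply d m G v) {..<d}}
    \<le> (2 * exp (- u\<^sup>2 / 4)) ^ d"
proof (cases "L2_set v {..<m} = 0")
  case True
  then have "mat_apply d m G v = (\<lambda>_. 0)" for G
    by (auto simp: L2_set_eq_0_iff mat_apply_def)
  then have "\<not> u * l < L2_set (mat_apply d m G v) {..<d}" for G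
    using assms by (simp add: L2_set_0' not_less)
  then show ?thesis
    by simp
next
  case False
  interpret prob_space "gaussian_matrix d m"
    by (rule prob_space_gaussian_matrix[OF d])
  let ?l = "L2_set v {..<m}"
  let ?A = "{G\<in>space (gaussian_matrix d m). u * l < L2_set (mat_apply d m G v) {..<d}}"
  have l: "0 < ?l"
    using False by (simp add: less_le)
  \<comment> \<open>Here \<open>s = - 1 / 4\<close>, so \<open>1 + 2 * s\<close> is
    \<open>1 / 2\<close> and each coordinate contributes the factor \<open>sqrt 2\<close>, which is
    below 2.\<close>
  define t where "t = real d / (4 * ?l\<^sup>2)"
  have t: "0 < t"
    using d l by (simp add: t_def)
  have [measurable]: "(\<lambda>G. L2_set (mat_apply d m G v) {..<d}) \<in> borel_measurable (gaussian_matrix d m)"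
    unfolding L2_set_def by measurable
  have "u * ?l \<le> u * l"
    using u v by (intro mult_left_mono) auto
  then have "emeasure (gaussian_matrix d m) ?A
    \<le> emeasure (gaussian_matrix d m) {G\<in>space (gaussian_matrix d m). (L2_set (mat_apply d m G v) {..<d})\<^sup>2 \<ge> (u * ?l)\<^sup>2}"
    using u by (intro emeasure_mono) (auto intro!: power_mono)
  also have "\<dots> \<le> ennreal (exp (- t * (u * ?l)\<^sup>2)) *
    (\<integral>\<^sup>+G. ennreal (exp (t * (L2_set (mat_apply d m G v) {..<d})\<^sup>2)) * indicator (space (gaussian_matrix d m)) G \<partial>gaussian_matrix d m)"
    by (rule Chernoff_ineq_nn_integral_ge[OF t]) measurable
  also have "(\<integral>\<^sup>+G. ennreal (exp (t * (L2_set (mat_apply d m G v) {..<d})\<^sup>2)) * indicator (space (gaussian_matrix d m)) G \<partial>gaussian_matrix d m)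
     = (\<integral>\<^sup>+G. ennreal (exp (- (- t) * (L2_set (mat_apply d m G v) {..<d})\<^sup>2)) \<partial>gaussian_matrix d m)"
    by (intro nn_integral_cong) simp
  also have "\<dots> = ennreal ((1 / sqrt (1 + 2 * (- 1 / 4))) ^ d)"
    using l d by (intro nn_integral_exp_L2_set_mat_apply) (auto simp: t_def)
  also have "exp (- t * (u * ?l)\<^sup>2) = exp (- u\<^sup>2 / 4) ^ d"
    using l by (simp add: t_def exp_of_nat_mult[symmetric] power_mult_distrib)
  also have "ennreal (exp (- u\<^sup>2 / 4) ^ d) * ennreal ((1 / sqrt (1 + 2 * (- 1 / 4))) ^ d)
    = ennreal ((1 / sqrt (1 + 2 * (- 1 / 4)) * exp (- u\<^sup>2 / 4)) ^ d)"
    by (simp add: ennreal_mult'[symmetric] power_mult_distrib power_divide mult.commute)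
  also have "\<dots> \<le> ennreal ((2 * exp (- u\<^sup>2 / 4)) ^ d)"
    by (intro ennreal_leI power_mono mult_right_mono) (auto simp: real_sqrt_divide real_le_lsqrt)
  finally show ?thesis
    by (simp add: emeasure_eq_measure)
qed

text \<open>The variance \<open>1 / d\<close> of the entries is the right normalisation: each of the
  \<open>d\<close> coordinates carries the fraction \<open>1 / d\<close> of the squared
  length.\<close>

lemma gaussian_matrix_second_moment:
  assumes d: "1 \<le> d"
  shows "integrable (gaussian_matrix d m) (\<lambda>G. (L2_set (mat_apply d m G v) {..<d})\<^sup>2)"
    and "(\<integral>G. (L2_set (mat_apply d m G v) {..<d})\<^sup>2 \<partial>gaussian_matrix d m) = (L2_set v {..<m})\<^sup>2"
proof -
  let ?M = "gaussian_matrix d m"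
  have "has_bochner_integral ?M (\<lambda>G. (mat_apply d m G v i)\<^sup>2) ((L2_set v {..<m})\<^sup>2 / d)" if i: "i < d" for i
  proof (cases "L2_set v {..<m} = 0")
    case True
    then have "mat_apply d m G v = (\<lambda>_. 0)" for G
      by (auto simp: L2_set_eq_0_iff mat_apply_def)
    then show ?thesis
      using True by (simp add: has_bochner_integral_zero)
  next
    case False
    then have v: "0 < L2_set v {..<m}"
      by (simp add: less_le)
    define \<sigma> where "\<sigma> = L2_set v {..<m} / sqrt (real d)"
    have \<sigma>: "0 < \<sigma>"
      using v d by (simp add: \<sigma>_def)
    have D: "distributed ?M lborel (\<lambda>G. mat_apply d m G v i) (normal_density 0 \<sigma>)"
      using distributed_mat_apply[OF i v] by (simp add: \<sigma>_def)
    have "has_bochner_integral lborel (\<lambda>x. normal_density 0 \<sigma> x * x\<^sup>2) (\<sigma>\<^sup>2)"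
      using normal_moment_even[OF \<sigma>, of 0 1] by (simp add: eval_nat_numeral)
    then have "integrable ?M (\<lambda>G. (mat_apply d m G v i)\<^sup>2)" "(\<integral>G. (mat_apply d m G v i)\<^sup>2 \<partial>?M) = \<sigma>\<^sup>2"
      using distributed_integrable[OF D, of "\<lambda>x. x\<^sup>2"] distributed_integral[OF D, of "\<lambda>x. x\<^sup>2"]
      by (auto simp: has_bochner_integral_iff)
    then show ?thesis
      using d by (simp add: has_bochner_integral_iff \<sigma>_def power_divide)
  qed
  then have "has_bochner_integral ?M (\<lambda>G. \<Sum>i<d. (mat_apply d m G v i)\<^sup>2) (\<Sum>i<d. (L2_set v {..<m})\<^sup>2 / d)"
    by (intro has_bochner_integral_sum) auto
  then have "has_bochner_integral ?M (\<lambda>G. (L2_set (mat_apply d m G v) {..<d})\<^sup>2) ((L2_set v {..<m})\<^sup>2)"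
    using d by (simp add: L2_set_def sum_nonneg)
  then show "integrable ?M (\<lambda>G. (L2_set (mat_apply d m G v) {..<d})\<^sup>2)"
    and "(\<integral>G. (L2_set (mat_apply d m G v) {..<d})\<^sup>2 \<partial>?M) = (L2_set v {..<m})\<^sup>2"
    by (auto simp: has_bochner_integral_iff)
qed

subsection \<open>Points outside a ball stay away from its centre\<close>

lemma (in Metric_space) chain_le:
  assumes "\<And>i. i \<le> n \<Longrightarrow> f i \<in> M"
  shows "d (f 0) (f n) \<le> (\<Sum>i<n. d (f i) (f (Suc i)))"
  using assms
proof (induction n)
  case (Suc n)
  have "d (f 0) (f (Suc n)) \<le> d (f 0) (f n) + d (f n) (f (Suc n))"
    by (rule triangle) (use Suc.prems in auto)
  then show ?case
    using Suc by fastforce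
qed simp

lemma sum_geometric_le:
  fixes c :: real
  assumes "0 \<le> c" "c < 1"
  shows "(\<Sum>i<n. c ^ i) \<le> 1 / (1 - c)"
  using assms by (simp add: sum_gp_strict divide_right_mono)

lemma dyadic_scale:
  fixes r D :: real
  assumes "0 < r" "r \<le> D"
  obtains k where "2 ^ k * r \<le> D" "D < 2 ^ Suc k * r"
proof -
  obtain n where "D / r < 2 ^ n"
    using real_arch_pow[of 2 "D / r"] by auto
  then have n: "D < 2 ^ n * r"
    using assms by (simp add: field_simps)
  define l where "l = (LEAST n. D < 2 ^ n * r)"
  have l: "D < 2 ^ l * r"
    unfolding l_def using n by (rule LeastI)
  then obtain k where k: "l = Suc k"
    using assms by (cases l) auto
  have "\<not> D < 2 ^ k * r"
    using not_less_Least[of k "\<lambda>n. D < 2 ^ n * r"] k by (simp add: l_def)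
  with l k show ?thesis
    using that by (simp add: not_less)
qed

text \<open>Union bound over dyadic annuli around \<open>p\<close>. In the annulus of inner radius \<open>2 ^ k * r\<close> the
  chain starts at a net of absolute scale \<open>r / 2 ^ 16\<close>, independent of \<open>k\<close>, while the image radius
  to be excluded grows like \<open>(3 / 2) ^ k\<close>. This is slower than the radius of the annulus, so the
  lower tail decays in \<open>k\<close>, but fast enough that the upper tail of the chain decays in \<open>k\<close> too.\<close>

lemma far_points_stay_far:
  assumes X: "finite X" "X \<subseteq> topspace (Euclidean_space m)" "p \<in> X" and r: "0 < r"
    and d: "1 \<le> d" "40 * ln (real (doubling_constant m X)) \<le> real d"
  shows "measure (gaussian_matrix d m) {G\<in>space (gaussian_matrix d m).
      \<exists>q\<in>X. r \<le> edist m p q \<and> edist d (mat_apply d m G p) (mat_apply d m G q) < r / 2 ^ 11} \<le> 1 / 2"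
    (is "measure ?M ?bad \<le> _")
proof -
  interpret prob_space ?M
    by (rule prob_space_gaussian_matrix[OF d(1)])
  interpret Em: Metric_space "topspace (Euclidean_space m)" "edist m"
    by (rule Metric_space_edist)
  interpret Ed: Metric_space "topspace (Euclidean_space d)" "edist d"
    by (rule Metric_space_edist)
  let ?D = "\<lambda>G x y. edist d (mat_apply d m G x) (mat_apply d m G y)"
  define \<Lambda> where "\<Lambda> = doubling_constant m X"
  have \<Lambda>1: "1 \<le> real \<Lambda>"
    using doubling_constant_pos[of X m] X by (auto simp: \<Lambda>_def)
  \<comment> \<open>The lower bound on \<open>d\<close> turns every net size into a
    \<open>d\<close>-th power, so union bounds and tail bounds can be compared base by base.\<close>
  have \<Lambda>: "real \<Lambda> ^ n \<le> exp (real n / 40) ^ d" for n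
  proof -
    have "real \<Lambda> = exp (ln (real \<Lambda>))"
      using \<Lambda>1 by simp
    also have "\<dots> \<le> exp (real d / 40)"
      using d(2) by (simp add: \<Lambda>_def)
    finally have "real \<Lambda> ^ n \<le> exp (real d / 40) ^ n"
      by (intro power_mono) auto
    also have "\<dots> = exp (real n / 40) ^ d"
      by (simp add: exp_of_nat_mult[symmetric] mult.commute)
    finally show ?thesis .
  qed
  \<comment> \<open>After \<open>k + 17 + j\<close> halvings the radius \<open>2 ^ Suc k * r\<close>
    has shrunk to \<open>r / 2 ^ (16 + j)\<close>, whatever \<open>k\<close> is.\<close>
  have "\<forall>k j. \<exists>S\<subseteq>X. card S \<le> \<Lambda> ^ (k + 17 + j) \<and>
      ball_in m X p (2 ^ Suc k * r) \<subseteq> (\<Union>s\<in>S. ball_in m X s (2 ^ Suc k * r / 2 ^ (k + 17 + j)))"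
    unfolding \<Lambda>_def using X r by (intro allI doubling_constant_iterated_cover) auto
  moreover have "2 ^ Suc k * r / 2 ^ (k + 17 + j) = r / 2 ^ (16 + j)" for k j
    by (simp add: power_add)
  ultimately have "\<forall>k j. \<exists>S\<subseteq>X. card S \<le> \<Lambda> ^ (k + 17 + j) \<and>
      ball_in m X p (2 ^ Suc k * r) \<subseteq> (\<Union>s\<in>S. ball_in m X s (r / 2 ^ (16 + j)))"
    by (simp only: simp_thms)
  then obtain S where S: "\<And>k j. S k j \<subseteq> X" and card_S: "\<And>k j. card (S k j) \<le> \<Lambda> ^ (k + 17 + j)"
    and cover: "\<And>k j. ball_in m X p (2 ^ Suc k * r) \<subseteq> (\<Union>s\<in>S k j. ball_in m X s (r / 2 ^ (16 + j)))"
    by metis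
  have finS: "finite (S k j)" for k j
    using S X finite_subset by blast
  have card_S': "real (card (S k j)) \<le> real \<Lambda> ^ (k + 17 + j)" for k j
    using card_S[of k j] by (metis of_nat_le_iff of_nat_power)
  define \<sigma> where "\<sigma> k = r / 2 ^ 11 * (3 / 2) ^ k" for k :: nat
  \<comment> \<open>\<open>l j\<close> bounds the distance between approximations of one point in
    two consecutive nets, and \<open>u\<close> is the stretching tolerated on such a link. The
    allowed image lengths \<open>u (k + j) * l j\<close> form a geometric series in \<open>j\<close>
    with ratio \<open>3 / 4\<close> and sum at most \<open>\<sigma> k\<close>.\<close>
  define l where "l j = 2 * r / 2 ^ (16 + j)" for j :: nat
  define u where "u n = 4 * (3 / 2 :: real) ^ n" for n :: nat
  define L where "L k = {G\<in>space ?M. \<exists>s\<in>S k 0. 2 ^ k * r / 2 \<le> edist m p s \<and> ?D G p s \<le> 2 * \<sigma> k}" for k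
  define U where "U k j = {G\<in>space ?M. \<exists>s\<in>S k j. \<exists>t\<in>S k (Suc j).
      edist m s t \<le> l j \<and> u (k + j) * l j < ?D G s t}" for k j
  have L_sets: "L k \<in> sets ?M" for k
    unfolding L_def using finS by measurable
  have U_sets: "U k j \<in> sets ?M" for k j
    unfolding U_def using finS by measurable
  have edist_D: "?D G x y = L2_set (mat_apply d m G (\<lambda>j. x j - y j)) {..<d}" for G x y
    by (rule edist_mat_apply)

  \<comment> \<open>Relative to the inner half-radius \<open>2 ^ k * r / 2\<close>, the image radius
    \<open>2 * \<sigma> k\<close> is \<open>?\<epsilon>\<close>. The net size costs at most
    \<open>2 * (7 / 6) ^ k\<close> in the base, and \<open>7 / 6 * (3 / 4) = 7 / 8\<close> still
    decays.\<close>
  have L_le: "prob (L k) \<le> 6 / 512 * (7 / 8) ^ k" for k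
  proof -
    let ?\<epsilon> = "(3 / 4) ^ k / 512 :: real"
    let ?L = "\<lambda>s. {G\<in>space ?M. 2 ^ k * r / 2 \<le> edist m p s \<and> ?D G p s \<le> 2 * \<sigma> k}"
    have one: "prob (?L s) \<le> (3 * ?\<epsilon>) ^ d" for s
    proof (cases "2 ^ k * r / 2 \<le> edist m p s")
      case True
      have "0 < 2 ^ k * r / 2"
        using r by simp
      then have pos: "0 < L2_set (\<lambda>j. p j - s j) {..<m}"
        using True unfolding edist_def by linarith
      have "(3 / 2 :: real) ^ k = (3 / 4) ^ k * 2 ^ k"
        by (simp only: power_mult_distrib[symmetric]) simp
      then have "2 * \<sigma> k = ?\<epsilon> * (2 ^ k * r / 2)"
        unfolding \<sigma>_def by (simp only:) simp
      also have "\<dots> \<le> ?\<epsilon> * edist m p s"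
        using True by (intro mult_left_mono) auto
      finally have "prob (?L s) \<le> prob {G\<in>space ?M. L2_set (mat_apply d m G (\<lambda>j. p j - s j)) {..<d}
          \<le> ?\<epsilon> * L2_set (\<lambda>j. p j - s j) {..<m}}"
        unfolding edist_D[symmetric] edist_def[of m, symmetric]
        by (intro finite_measure_mono) auto
      also have "\<dots> \<le> (3 * ?\<epsilon>) ^ d"
        by (rule gaussian_matrix_lower_tail[OF pos d(1)]) simp
      finally show ?thesis .
    qed auto
    have card: "real (card (S k 0)) \<le> exp (real (k + 17) / 40) ^ d"
      using order_trans[OF card_S'[of k 0] \<Lambda>[of "k + 17 + 0"]] by (simp only: add_0_right)
    have L_eq: "L k = (\<Union>s\<in>S k 0. ?L s)"
      by (auto simp: L_def)
    have "prob (L k) \<le> (\<Sum>s\<in>S k 0. prob (?L s))"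
      unfolding L_eq by (intro finite_measure_subadditive_finite finS) auto
    also have "\<dots> \<le> real (card (S k 0)) * (3 * ?\<epsilon>) ^ d"
      by (rule sum_bounded_above) (rule one)
    also have "\<dots> \<le> exp (real (k + 17) / 40) ^ d * (3 * ?\<epsilon>) ^ d"
      by (intro mult_right_mono card zero_le_power mult_nonneg_nonneg) auto
    also have "\<dots> = (exp (real (k + 17) / 40) * (3 * ?\<epsilon>)) ^ d"
      by (simp only: power_mult_distrib)
    also have "\<dots> \<le> (6 / 512 * (7 / 8) ^ k) ^ d"
    proof (intro power_mono)
      have e1: "exp (17 / 40 :: real) \<le> 2"
        by (rule order_trans[OF exp_bound]) (auto simp: power2_eq_square)
      have e2: "exp (1 / 40 :: real) \<le> 7 / 6"
        by (rule order_trans[OF exp_bound]) (auto simp: power2_eq_square)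
      have "exp (real (k + 17) / 40) = exp (real k * (1 / 40)) * exp (17 / 40)"
        by (simp add: exp_add[symmetric] add_divide_distrib)
      also have "\<dots> = exp (1 / 40) ^ k * exp (17 / 40)"
        by (simp only: exp_of_nat_mult)
      also have "\<dots> \<le> (7 / 6) ^ k * 2"
        using e1 e2 by (intro mult_mono power_mono) auto
      finally have "exp (real (k + 17) / 40) * (3 * ?\<epsilon>) \<le> (7 / 6) ^ k * 2 * (3 * ?\<epsilon>)"
        by (intro mult_right_mono) auto
      also have "\<dots> = 6 / 512 * ((7 / 6) ^ k * (3 / 4) ^ k)"
        by simp
      also have "(7 / 6 :: real) ^ k * (3 / 4) ^ k = (7 / 8) ^ k"
        by (simp only: power_mult_distrib[symmetric]) simp
      finally show "exp (real (k + 17) / 40) * (3 * ?\<epsilon>) \<le> 6 / 512 * (7 / 8) ^ k" .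
    qed auto
    \<comment> \<open>The base is at most 1 and \<open>d\<close> is at least 1, so the power may be
      dropped, leaving a bound independent of \<open>d\<close>.\<close>
    also have "\<dots> \<le> (6 / 512 * (7 / 8) ^ k) ^ 1"
      using d(1) by (intro power_decreasing mult_le_one power_le_one) auto
    finally show ?thesis by simp
  qed

  have U_le: "prob (U k j) \<le> 1 / 4 * (1 / 8) ^ (k + j)" for k j
  proof -
    let ?n = "k + j"
    let ?U = "\<lambda>(s, t). {G\<in>space ?M. edist m s t \<le> l j \<and> u ?n * l j < ?D G s t}"
    have one: "prob (?U st) \<le> (2 * exp (- (u ?n)\<^sup>2 / 4)) ^ d" for st
    proof -
      obtain s t where st: "st = (s, t)" by fastforce
      show ?thesis
      proof (cases "edist m s t \<le> l j")
        case True
        then show ?thesis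
          using gaussian_matrix_upper_tail[of "\<lambda>j. s j - t j" m "l j" d "u ?n"] r d(1)
          by (simp add: st edist_mat_apply edist_def[of m] l_def u_def)
      qed (simp add: st)
    qed
    have "real (card (S k j \<times> S k (Suc j))) \<le> real \<Lambda> ^ (k + 17 + j) * real \<Lambda> ^ (k + 17 + Suc j)"
      unfolding card_cartesian_product of_nat_mult by (intro mult_mono card_S' of_nat_0_le_iff zero_le_power)
    also have "\<dots> = real \<Lambda> ^ (35 + 2 * ?n)"
      by (simp only: power_add[symmetric]) (simp add: algebra_simps)
    finally have card: "real (card (S k j \<times> S k (Suc j))) \<le> exp (real (35 + 2 * ?n) / 40) ^ d"
      using \<Lambda>[of "35 + 2 * ?n"] by (rule order_trans)
    have U_eq: "U k j = (\<Union>st\<in>S k j \<times> S k (Suc j). ?U st)"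
      by (auto simp: U_def)
    have "prob (U k j) \<le> (\<Sum>st\<in>S k j \<times> S k (Suc j). prob (?U st))"
      unfolding U_eq by (intro finite_measure_subadditive_finite) (use finS in auto)
    also have "\<dots> \<le> real (card (S k j \<times> S k (Suc j))) * (2 * exp (- (u ?n)\<^sup>2 / 4)) ^ d"
      by (rule sum_bounded_above) (rule one)
    also have "\<dots> \<le> exp (real (35 + 2 * ?n) / 40) ^ d * (2 * exp (- (u ?n)\<^sup>2 / 4)) ^ d"
      by (intro mult_right_mono card zero_le_power mult_nonneg_nonneg) auto
    also have "\<dots> = (exp (real (35 + 2 * ?n) / 40) * (2 * exp (- (u ?n)\<^sup>2 / 4))) ^ d"
      by (simp only: power_mult_distrib)
    also have "\<dots> \<le> (1 / 4 * (1 / 8) ^ ?n) ^ d"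
    proof (intro power_mono)
      \<comment> \<open>Bernoulli's inequality replaces the exponential growth of \<open>u\<close>
        squared by a linear bound, already enough to absorb the number of pairs of net
        points.\<close>
      have "1 + real ?n * (5 / 4) \<le> (9 / 4) ^ ?n"
        using Bernoulli_inequality[of "5 / 4" ?n] by simp
      moreover have "((3 / 2 :: real) ^ ?n)\<^sup>2 = (9 / 4) ^ ?n"
        by (simp only: power2_eq_square power_mult_distrib[symmetric]) simp
      then have "(u ?n)\<^sup>2 / 4 = 4 * (9 / 4) ^ ?n"
        unfolding u_def by (simp only: power_mult_distrib) simp
      ultimately have "- (u ?n)\<^sup>2 / 4 \<le> - 4 - 4 * real ?n"
        by linarith
      then have "exp (- (u ?n)\<^sup>2 / 4) \<le> exp (- 4 - 4 * real ?n)"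
        by (simp only: exp_le_cancel_iff)
      moreover have "exp (real (35 + 2 * ?n) / 40) \<le> exp (1 + real ?n)"
        by (subst exp_le_cancel_iff) (simp add: field_simps)
      moreover have e: "2 \<le> exp (1::real)"
        using exp_ge_add_one_self[of 1] by simp
      ultimately have "exp (real (35 + 2 * ?n) / 40) * (2 * exp (- (u ?n)\<^sup>2 / 4))
        \<le> exp (1 + real ?n) * (exp 1 * exp (- 4 - 4 * real ?n))"
        by (intro mult_mono mult_nonneg_nonneg exp_ge_zero) auto
      also have "\<dots> = exp (- 2 + - 3 * real ?n)"
        by (simp add: exp_add[symmetric])
      also have "\<dots> = exp (- 1) ^ 2 * (exp (- 1) ^ 3) ^ ?n"
        by (simp add: exp_of_nat_mult[symmetric] power_mult[symmetric] exp_add[symmetric])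
      also have "\<dots> \<le> (1 / 2) ^ 2 * ((1 / 2) ^ 3) ^ ?n"
        using e by (intro mult_mono power_mono) (auto simp: exp_minus field_simps)
      also have "\<dots> = 1 / 4 * (1 / 8) ^ ?n"
        by (simp add: power_divide)
      finally show "exp (real (35 + 2 * ?n) / 40) * (2 * exp (- (u ?n)\<^sup>2 / 4)) \<le> 1 / 4 * (1 / 8) ^ ?n" .
    qed auto
    also have "\<dots> \<le> (1 / 4 * (1 / 8) ^ ?n) ^ 1"
      using d(1) by (intro power_decreasing mult_le_one power_le_one) auto
    finally show ?thesis by (simp add: mult_right_mono)
  qed

  \<comment> \<open>Finiteness of \<open>X\<close> leaves finitely many annuli,
    \<open>k < K\<close>, and makes every chain finite: by level \<open>J\<close> the approximating
    net point is the point itself.\<close>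
  obtain K where K: "\<And>q. q \<in> X \<Longrightarrow> edist m p q < 2 ^ K * r"
  proof -
    obtain K where "Max (edist m p ` X) / r < 2 ^ K"
      using real_arch_pow[of 2] by auto
    then have "Max (edist m p ` X) < 2 ^ K * r"
      using r by (simp add: field_simps)
    moreover have "edist m p q \<le> Max (edist m p ` X)" if "q \<in> X" for q
      using X that by (intro Max_ge) auto
    ultimately show ?thesis
      using that[of K] by (meson le_less_trans)
  qed
  obtain J where J: "\<And>x y. x \<in> X \<Longrightarrow> y \<in> X \<Longrightarrow> edist m x y \<le> r / 2 ^ (16 + J) \<Longrightarrow> x = y"
  proof -
    define E where "E = (\<lambda>(x, y). edist m x y) ` {(x, y)\<in>X \<times> X. x \<noteq> y}"
    have fin: "finite E"
      unfolding E_def using X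
      by (intro finite_imageI finite_subset[OF _ finite_cartesian_product[of X X]]) auto
    have pos: "0 < e" if e: "e \<in> E" for e
    proof -
      obtain x y where "x \<in> X" "y \<in> X" "x \<noteq> y" "e = edist m x y"
        using e by (auto simp: E_def)
      moreover from this have "edist m x y \<noteq> 0"
        using Em.zero[of x y] X(2) by blast
      ultimately show ?thesis
        using Em.nonneg[of x y] by linarith
    qed
    define \<delta> where "\<delta> = Min (insert 1 E)"
    have "0 < \<delta>"
      using fin pos by (auto simp: \<delta>_def Min_gr_iff)
    obtain J where "r / \<delta> < 2 ^ J"
      using real_arch_pow[of 2 "r / \<delta>"] by auto
    then have *: "r / 2 ^ J < \<delta>"
      using \<open>0 < \<delta>\<close> by (simp add: field_simps)
    have "r / 2 ^ (16 + J) \<le> r / 2 ^ J"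
      using r by (intro divide_left_mono power_increasing) auto
    with * have less: "r / 2 ^ (16 + J) < \<delta>"
      by linarith
    show ?thesis
    proof (rule that[of J], rule ccontr)
      fix x y assume xy: "x \<in> X" "y \<in> X" "edist m x y \<le> r / 2 ^ (16 + J)" "x \<noteq> y"
      then have "edist m x y \<in> E"
        by (auto simp: E_def)
      then have "\<delta> \<le> edist m x y"
        unfolding \<delta>_def using fin by (intro Min_le) auto
      then show False
        using less xy(3) by linarith
    qed
  qed

  have "?bad \<subseteq> (\<Union>k<K. L k) \<union> (\<Union>kj\<in>{..<K} \<times> {..<J}. U (fst kj) (snd kj))"
  proof (rule subsetI, rule ccontr)
    fix G assume "G \<in> ?bad" and "G \<notin> (\<Union>k<K. L k) \<union> (\<Union>kj\<in>{..<K} \<times> {..<J}. U (fst kj) (snd kj))"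
    then obtain q where G: "G \<in> space ?M" and q: "q \<in> X" "r \<le> edist m p q" "?D G p q < r / 2 ^ 11"
      and nL: "\<And>k. k < K \<Longrightarrow> G \<notin> L k" and nU: "\<And>k j. k < K \<Longrightarrow> j < J \<Longrightarrow> G \<notin> U k j"
      by auto
    obtain k where k: "2 ^ k * r \<le> edist m p q" "edist m p q < 2 ^ Suc k * r"
      using dyadic_scale[OF r q(2)] .
    have "2 ^ k * r < 2 ^ K * r"
      using k(1) K[OF q(1)] by linarith
    then have kK: "k < K"
      using r by simp
    have "q \<in> ball_in m X p (2 ^ Suc k * r)"
      using q k by (simp add: ball_in_def)
    then have "\<forall>j. \<exists>s\<in>S k j. edist m s q \<le> r / 2 ^ (16 + j)"
      using cover[of k] by (fastforce simp: ball_in_def)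
    \<comment> \<open>\<open>s j\<close> approximates \<open>q\<close> in the \<open>j\<close>-th
      net, so the chain leads from a coarse net point \<open>s 0\<close> to
      \<open>s J = q\<close>.\<close>
    then obtain s where s: "\<And>j. s j \<in> S k j" "\<And>j. edist m (s j) q \<le> r / 2 ^ (16 + j)"
      by metis
    have sX: "s j \<in> X" for j
      using s(1) S by blast
    have sJ: "s J = q"
      using J[OF sX q(1) s(2)] .
    have "?D G (s 0) (s J) \<le> (\<Sum>j<J. ?D G (s j) (s (Suc j)))"
      by (rule Ed.chain_le[of J "\<lambda>j. mat_apply d m G (s j)"]) simp
    also have "\<dots> \<le> (\<Sum>j<J. r / 2 ^ 13 * (3 / 2) ^ k * (3 / 4) ^ j)"
    proof (intro sum_mono)
      fix j assume "j \<in> {..<J}"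
      have "edist m (s j) (s (Suc j)) \<le> edist m (s j) q + edist m q (s (Suc j))"
        using X sX q by (intro Em.triangle) auto
      also have "\<dots> \<le> r / 2 ^ (16 + j) + r / 2 ^ (16 + Suc j)"
        using s(2)[of j] s(2)[of "Suc j"] Em.commute[of q] by (intro add_mono) auto
      also have "\<dots> \<le> l j"
        using r by (simp add: l_def field_simps)
      finally have "edist m (s j) (s (Suc j)) \<le> l j" .
      then have "?D G (s j) (s (Suc j)) \<le> u (k + j) * l j"
        using nU[OF kK, of j] s(1) G \<open>j \<in> _\<close> by (fastforce simp: U_def not_less)
      also have "\<dots> = r / 2 ^ 13 * (3 / 2) ^ k * ((3 / 2) ^ j / 2 ^ j)"
        by (simp add: u_def l_def power_add)
      also have "(3 / 2 :: real) ^ j / 2 ^ j = (3 / 4) ^ j"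
        by (simp only: power_divide[symmetric]) simp
      finally show "?D G (s j) (s (Suc j)) \<le> r / 2 ^ 13 * (3 / 2) ^ k * (3 / 4) ^ j" .
    qed
    also have "\<dots> = r / 2 ^ 13 * (3 / 2) ^ k * (\<Sum>j<J. (3 / 4) ^ j)"
      by (simp only: sum_distrib_left)
    also have "\<dots> \<le> r / 2 ^ 13 * (3 / 2) ^ k * 4"
      using r sum_geometric_le[of "3 / 4" J] by (intro mult_left_mono) auto
    also have "\<dots> = \<sigma> k"
      by (simp add: \<sigma>_def)
    finally have chain: "?D G (s 0) q \<le> \<sigma> k"
      by (simp add: sJ)
    \<comment> \<open>The coarse point \<open>s 0\<close> is still at distance at least
      \<open>2 ^ k * r / 2\<close> from \<open>p\<close>. Outside \<open>L k\<close> its image is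
      more than \<open>2 * \<sigma> k\<close> away, and the chain loses at most
      \<open>\<sigma> k\<close> of this.\<close>
    have "1 * r \<le> 2 ^ k * r"
      using r by (intro mult_right_mono) auto
    moreover have "r / 2 ^ 16 \<le> r / 2"
      using r by simp
    ultimately have "r / 2 ^ 16 \<le> 2 ^ k * r / 2"
      by linarith
    moreover have "edist m p q \<le> edist m p (s 0) + edist m (s 0) q"
      using X sX q by (intro Em.triangle) auto
    ultimately have "2 ^ k * r / 2 \<le> edist m p (s 0)"
      using k(1) s(2)[of 0] by (simp only: add_0_right)
    then have "2 * \<sigma> k < ?D G p (s 0)"
      using nL[OF kK] s(1) G by (fastforce simp: L_def not_le)
    also have "\<dots> \<le> ?D G p q + ?D G q (s 0)"
      by (intro Ed.triangle) auto
    finally have "\<sigma> k < ?D G p q"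
      using chain Ed.commute[of "mat_apply d m G q"] by simp
    moreover have "r / 2 ^ 11 \<le> \<sigma> k"
      using r mult_left_mono[of 1 "(3 / 2) ^ k" "r / 2 ^ 11"] one_le_power[of "3 / 2 :: real" k]
      by (simp add: \<sigma>_def)
    ultimately show False
      using q(3) by linarith
  qed
  then have "prob ?bad \<le> prob ((\<Union>k<K. L k) \<union> (\<Union>kj\<in>{..<K} \<times> {..<J}. U (fst kj) (snd kj)))"
    by (intro finite_measure_mono) (auto intro!: L_sets U_sets sets.Un sets.finite_UN)
  also have "\<dots> \<le> prob (\<Union>k<K. L k) + prob (\<Union>kj\<in>{..<K} \<times> {..<J}. U (fst kj) (snd kj))"
    by (intro measure_Un_le) (auto intro!: L_sets U_sets sets.finite_UN)
  also have "\<dots> \<le> (\<Sum>k<K. prob (L k)) + (\<Sum>kj\<in>{..<K} \<times> {..<J}. prob (U (fst kj) (snd kj)))"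
    by (intro add_mono finite_measure_subadditive_finite) (auto intro!: L_sets U_sets)
  also have "\<dots> \<le> (\<Sum>k<K. 6 / 512 * (7 / 8) ^ k) + (\<Sum>kj\<in>{..<K} \<times> {..<J}. 1 / 4 * (1 / 8) ^ (fst kj + snd kj))"
    by (intro add_mono sum_mono L_le U_le)
  also have "(\<Sum>kj\<in>{..<K} \<times> {..<J}. 1 / 4 * (1 / 8 :: real) ^ (fst kj + snd kj))
      = 1 / 4 * (\<Sum>kj\<in>{..<K} \<times> {..<J}. (1 / 8) ^ fst kj * (1 / 8) ^ snd kj)"
    by (simp only: sum_distrib_left power_add)
  also have "(\<Sum>kj\<in>{..<K} \<times> {..<J}. (1 / 8 :: real) ^ fst kj * (1 / 8) ^ snd kj)
      = (\<Sum>k<K. (1 / 8) ^ k) * (\<Sum>j<J. (1 / 8) ^ j)"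
    by (simp only: sum_product sum.cartesian_product case_prod_unfold)
  also have "(\<Sum>k<K. 6 / 512 * (7 / 8 :: real) ^ k) = 6 / 512 * (\<Sum>k<K. (7 / 8) ^ k)"
    by (simp only: sum_distrib_left)
  \<comment> \<open>The two terms are \<open>3 / 32\<close> and \<open>16 / 49\<close>, together
    below \<open>1 / 2\<close>.\<close>
  also have "6 / 512 * (\<Sum>k<K. (7 / 8) ^ k) + 1 / 4 * ((\<Sum>k<K. (1 / 8) ^ k) * (\<Sum>j<J. (1 / 8) ^ j))
      \<le> 6 / 512 * (1 / (1 - 7 / 8)) + 1 / 4 * (1 / (1 - 1 / 8) * (1 / (1 - 1 / 8 :: real)))"
    by (intro add_mono mult_left_mono mult_mono sum_geometric_le sum_nonneg) auto
  also have "\<dots> \<le> 1 / 2"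
    by simp
  finally show ?thesis .
qed

subsection \<open>Expected cost of an optimal projected solution\<close>

lemma borel_measurable_Min_finite:
  fixes f :: "'i \<Rightarrow> 'a \<Rightarrow> real"
  assumes "finite I" "I \<noteq> {}" "\<And>i. i \<in> I \<Longrightarrow> f i \<in> borel_measurable M"
  shows "(\<lambda>x. Min ((\<lambda>i. f i x) ` I)) \<in> borel_measurable M"
  using assms by (induction I rule: finite_ne_induct) auto

text \<open>A fibre with \<open>n\<close> points contributes \<open>n\<close> copies of the value
  divided by \<open>n\<close>. Writing the fibre size as a sum of indicators makes its measurability
  in the matrix a matter of finite sums.\<close>

lemma sum_image_eq_weighted_sum:
  fixes h :: "'b \<Rightarrow> real"
  assumes "finite A"
  shows "sum h (g ` A) = (\<Sum>x\<in>A. h (g x) / (\<Sum>x'\<in>A. if g x' = g x then 1 else 0))"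
proof -
  have card: "(\<Sum>x'\<in>A. if g x' = y then 1 else 0) = real (card {x\<in>A. g x = y})" for y
    using assms by (simp add: sum.If_cases Int_def)
  have "(\<Sum>x\<in>A. h (g x) / (\<Sum>x'\<in>A. if g x' = g x then 1 else 0))
      = (\<Sum>y\<in>g ` A. \<Sum>x | x \<in> A \<and> g x = y. h (g x) / real (card {x'\<in>A. g x' = g x}))"
    unfolding card by (rule sum.image_gen[OF assms])
  also have "\<dots> = (\<Sum>y\<in>g ` A. h y)"
  proof (rule sum.cong[OF refl])
    fix y assume "y \<in> g ` A"
    then have "card {x\<in>A. g x = y} \<noteq> 0"
      using assms by auto
    moreover have "(\<Sum>x | x \<in> A \<and> g x = y. h (g x) / real (card {x'\<in>A. g x' = g x}))
        = (\<Sum>x | x \<in> A \<and> g x = y. h y / real (card {x\<in>A. g x = y}))"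
      by (intro sum.cong) auto
    ultimately show "(\<Sum>x | x \<in> A \<and> g x = y. h (g x) / real (card {x'\<in>A. g x' = g x})) = h y"
      by simp
  qed
  finally show ?thesis by simp
qed

lemma fl_cost_nonneg:
  assumes "finite F" "F \<noteq> {}"
  shows "0 \<le> fl_cost n Y F"
  unfolding fl_cost_def using assms by (intro add_nonneg_nonneg sum_nonneg) auto

text \<open>\<open>mat_apply d m G ` X\<close> is a set, so the cost is not a sum over \<open>X\<close> where the projection
  identifies points. Weighting each point by the inverse size of its fibre makes it one.\<close>

lemma measurable_fl_cost_mat_apply:
  assumes X: "finite X" and S: "S \<subseteq> X" "S \<noteq> {}"
  shows "(\<lambda>G. fl_cost d (mat_apply d m G ` X) (mat_apply d m G ` S)) \<in> borel_measurable (gaussian_matrix d m)"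
proof -
  interpret Ed: Metric_space "topspace (Euclidean_space d)" "edist d"
    by (rule Metric_space_edist)
  let ?D = "\<lambda>G x y. edist d (mat_apply d m G x) (mat_apply d m G y)"
  \<comment> \<open>Coincidence of images is tested by distance zero, which is a measurable
    condition on the matrix.\<close>
  define w where "w A x G = (\<Sum>x'\<in>A. if ?D G x' x = 0 then 1 else (0::real))" for A x G
  have finS: "finite S"
    using X S finite_subset by blast
  have [measurable]: "w A x \<in> borel_measurable (gaussian_matrix d m)" for A x
    unfolding w_def by measurable
  have [measurable]: "(\<lambda>G. Min ((\<lambda>s. (?D G x s)\<^sup>2) ` S)) \<in> borel_measurable (gaussian_matrix d m)" for x
    using finS S by (intro borel_measurable_Min_finite) measurable
  have "fl_cost d (mat_apply d m G ` X) (mat_apply d m G ` S)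
      = (\<Sum>s\<in>S. 1 / w S s G) + (\<Sum>x\<in>X. Min ((\<lambda>s. (?D G x s)\<^sup>2) ` S) / w X x G)" for G
    using sum_image_eq_weighted_sum[OF finS, of "\<lambda>_. 1" "mat_apply d m G"]
    unfolding fl_cost_def w_def image_image by (simp add: sum_image_eq_weighted_sum[OF X])
  then show ?thesis
    by simp
qed

text \<open>A collision of two points means that a nonzero difference vector is mapped to length
  zero, and the lower tail bound holds for arbitrarily small \<open>\<epsilon>\<close>.\<close>

lemma AE_inj_on_mat_apply:
  assumes X: "finite X" "X \<subseteq> topspace (Euclidean_space m)" and d: "1 \<le> d"
  shows "AE G in gaussian_matrix d m. inj_on (mat_apply d m G) X"
proof -
  interpret prob_space "gaussian_matrix d m"
    by (rule prob_space_gaussian_matrix[OF d])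
  interpret Em: Metric_space "topspace (Euclidean_space m)" "edist m"
    by (rule Metric_space_edist)
  have "AE G in gaussian_matrix d m. mat_apply d m G x \<noteq> mat_apply d m G y"
    if xy: "x \<in> X" "y \<in> X" "x \<noteq> y" for x y
  proof -
    let ?v = "\<lambda>j. x j - y j"
    let ?N = "{G\<in>space (gaussian_matrix d m). L2_set (mat_apply d m G ?v) {..<d} \<le> 0}"
    have "edist m x y \<noteq> 0"
      using Em.zero[of x y] X(2) xy by blast
    then have v: "0 < L2_set ?v {..<m}"
      by (metis L2_set_nonneg edist_def less_le)
    have [measurable]: "(\<lambda>G. L2_set (mat_apply d m G ?v) {..<d}) \<in> borel_measurable (gaussian_matrix d m)"
      unfolding L2_set_def by measurable
    have "prob ?N \<le> 0 + e" if "0 < e" for e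
    proof -
      define \<epsilon> where "\<epsilon> = min e 1 / 3"
      have \<epsilon>: "0 < \<epsilon>"
        using that by (simp add: \<epsilon>_def)
      have "prob ?N \<le> prob {G\<in>space (gaussian_matrix d m).
          L2_set (mat_apply d m G ?v) {..<d} \<le> \<epsilon> * L2_set ?v {..<m}}"
        using \<epsilon> by (intro finite_measure_mono) (auto intro: order_trans[OF _ mult_nonneg_nonneg])
      also have "\<dots> \<le> (3 * \<epsilon>) ^ d"
        by (rule gaussian_matrix_lower_tail[OF v d \<epsilon>])
      also have "\<dots> \<le> (3 * \<epsilon>) ^ 1"
        using d that by (intro power_decreasing) (auto simp: \<epsilon>_def)
      also have "\<dots> \<le> 0 + e"
        by (simp add: \<epsilon>_def)
      finally show ?thesis .
    qed
    then have "prob ?N \<le> 0"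
      by (rule field_le_epsilon)
    then have "prob ?N = 0"
      by (simp add: measure_le_0_iff)
    then have "AE G in gaussian_matrix d m. G \<notin> ?N"
      by (intro AE_iff_measurable[THEN iffD2, of ?N]) (auto simp: emeasure_eq_measure)
    with AE_space show ?thesis
    proof eventually_elim
      case (elim G)
      then have "0 < edist d (mat_apply d m G x) (mat_apply d m G y)"
        by (simp add: edist_mat_apply)
      then show ?case
        by (auto simp: edist_def L2_set_0')
    qed
  qed
  then have "AE G in gaussian_matrix d m. \<forall>x\<in>X. \<forall>y\<in>X. x \<noteq> y \<longrightarrow> mat_apply d m G x \<noteq> mat_apply d m G y"
    using X(1) by (intro AE_finite_allI) auto
  then show ?thesis
    by eventually_elim (auto simp: inj_on_def)
qed

text \<open>The selection \<open>Fd\<close> is an arbitrary function, but its cost is the minimum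
  over the finitely many nonempty subsets of \<open>X\<close>, each with a measurable projected
  cost.\<close>

lemma fl_cost_optimum_measurable:
  assumes X: "finite X" "X \<noteq> {}"
    and opt: "\<And>G. G \<in> space (gaussian_matrix d m) \<Longrightarrow> fl_optimal d (mat_apply d m G ` X) (Fd G)"
  shows "(\<lambda>G. fl_cost d (mat_apply d m G ` X) (Fd G)) \<in> borel_measurable (gaussian_matrix d m)"
proof -
  let ?c = "\<lambda>G S. fl_cost d (mat_apply d m G ` X) (mat_apply d m G ` S)"
  have "fl_cost d (mat_apply d m G ` X) (Fd G) = Min ((\<lambda>S. ?c G S) ` (Pow X - {{}}))"
    if G: "G \<in> space (gaussian_matrix d m)" for G
  proof (rule Min_eqI[symmetric])
    show "finite (?c G ` (Pow X - {{}}))"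
      using X by simp
    show "fl_cost d (mat_apply d m G ` X) (Fd G) \<le> c" if c: "c \<in> ?c G ` (Pow X - {{}})" for c
    proof -
      obtain S where S: "S \<subseteq> X" "S \<noteq> {}" "c = ?c G S"
        using c by auto
      then have "fl_solution (mat_apply d m G ` X) (mat_apply d m G ` S)"
        by (auto simp: fl_solution_def)
      then show ?thesis
        using opt[OF G] S(3) by (simp add: fl_optimal_def)
    qed
    obtain S where "S \<subseteq> X" "Fd G = mat_apply d m G ` S" "Fd G \<noteq> {}"
      using opt[OF G] by (auto simp: fl_optimal_def fl_solution_def subset_image_iff)
    then show "fl_cost d (mat_apply d m G ` X) (Fd G) \<in> ?c G ` (Pow X - {{}})"
      by (intro image_eqI[of _ _ S]) auto
  qed
  moreover have "(\<lambda>G. Min ((\<lambda>S. ?c G S) ` (Pow X - {{}}))) \<in> borel_measurable (gaussian_matrix d m)"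
    using X by (intro borel_measurable_Min_finite measurable_fl_cost_mat_apply) auto
  ultimately show ?thesis
    by (subst measurable_cong[where g = "\<lambda>G. Min ((\<lambda>S. ?c G S) ` (Pow X - {{}}))"]) auto
qed

section \<open>Upper and lower bounds for the expected cost\<close>

lemma fl_cost_image_le:
  assumes X: "finite X" "F \<subseteq> X" and \<phi>: "\<And>x. x \<in> X \<Longrightarrow> \<phi> x \<in> F"
  shows "fl_cost n (g ` X) (g ` F) \<le> real (card F) + (\<Sum>x\<in>X. (edist n (g x) (g (\<phi> x)))\<^sup>2)"
proof -
  have finF: "finite F"
    using X finite_subset by blast
  let ?h = "\<lambda>y. Min ((\<lambda>f. (edist n y f)\<^sup>2) ` g ` F)"
  \<comment> \<open>Points with the same image are counted once on the left, so merging can only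
    lower the cost.\<close>
  have "sum ?h (g ` X) \<le> (\<Sum>x\<in>X. ?h (g x))"
  proof (cases "X = {}")
    case False
    then have "F \<noteq> {}"
      using \<phi> by blast
    then show ?thesis
      using sum_image_le[OF X(1), of ?h g] finF by auto
  qed simp
  also have "\<dots> \<le> (\<Sum>x\<in>X. (edist n (g x) (g (\<phi> x)))\<^sup>2)"
    using \<phi> finF by (intro sum_mono Min_le) auto
  finally show ?thesis
    unfolding fl_cost_def using card_image_le[OF finF, of g] by linarith
qed

text \<open>Integrability belongs to the conclusion because a Bochner integral defaults to 0 without
  it; the lower bound relies on it for monotonicity.\<close>

lemma expected_fl_cost_upper:
  assumes X: "finite X" "X \<noteq> {}" and d: "1 \<le> d" and F: "fl_solution X F"
    and opt: "\<And>G. G \<in> space (gaussian_matrix d m) \<Longrightarrow> fl_optimal d (mat_apply d m G ` X) (Fd G)"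
  shows "integrable (gaussian_matrix d m) (\<lambda>G. fl_cost d (mat_apply d m G ` X) (Fd G))"
    and "(\<integral>G. fl_cost d (mat_apply d m G ` X) (Fd G) \<partial>gaussian_matrix d m) \<le> fl_cost m X F"
proof -
  let ?M = "gaussian_matrix d m"
  interpret prob_space ?M
    by (rule prob_space_gaussian_matrix[OF d])
  have F': "F \<subseteq> X" "F \<noteq> {}" "finite F"
    using F X finite_subset by (auto simp: fl_solution_def)
  \<comment> \<open>The assignment uses distances before projection, so it does not depend on the
    matrix and the expectation can be taken term by term.\<close>
  define \<phi> where "\<phi> x = arg_min_on (\<lambda>f. (edist m x f)\<^sup>2) F" for x
  have \<phi>: "\<phi> x \<in> F" for x
    using arg_min_if_finite(1)[OF F'(3,2)] by (simp add: \<phi>_def)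
  have \<phi>_min: "(edist m x (\<phi> x))\<^sup>2 = Min ((\<lambda>f. (edist m x f)\<^sup>2) ` F)" for x
  proof (rule Min_eqI[symmetric])
    fix c assume "c \<in> (\<lambda>f. (edist m x f)\<^sup>2) ` F"
    then show "(edist m x (\<phi> x))\<^sup>2 \<le> c"
      using arg_min_least[OF F'(3,2), of _ "\<lambda>f. (edist m x f)\<^sup>2"] by (auto simp: \<phi>_def)
  qed (use F' \<phi> in auto)
  let ?b = "\<lambda>G. real (card F) + (\<Sum>x\<in>X. (edist d (mat_apply d m G x) (mat_apply d m G (\<phi> x)))\<^sup>2)"
  have moment: "integrable ?M (\<lambda>G. (edist d (mat_apply d m G x) (mat_apply d m G y))\<^sup>2)"
    "(\<integral>G. (edist d (mat_apply d m G x) (mat_apply d m G y))\<^sup>2 \<partial>?M) = (edist m x y)\<^sup>2" for x y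
    using gaussian_matrix_second_moment[OF d, of m "\<lambda>j. x j - y j"]
    by (simp_all add: edist_mat_apply edist_def[of m])
  have b_int: "integrable ?M ?b"
    using moment by auto
  have b_eq: "(\<integral>G. ?b G \<partial>?M) = fl_cost m X F"
    using moment by (simp add: fl_cost_def \<phi>_min prob_space)
  have le: "fl_cost d (mat_apply d m G ` X) (Fd G) \<le> ?b G" if "G \<in> space ?M" for G
  proof -
    have "fl_solution (mat_apply d m G ` X) (mat_apply d m G ` F)"
      using F' by (auto simp: fl_solution_def)
    then have "fl_cost d (mat_apply d m G ` X) (Fd G) \<le> fl_cost d (mat_apply d m G ` X) (mat_apply d m G ` F)"
      using opt[OF that] by (simp add: fl_optimal_def)
    also have "\<dots> \<le> ?b G"
      using X F' \<phi> by (intro fl_cost_image_le) auto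
    finally show ?thesis .
  qed
  have nonneg: "0 \<le> fl_cost d (mat_apply d m G ` X) (Fd G)" if "G \<in> space ?M" for G
  proof (rule fl_cost_nonneg)
    show "finite (Fd G)" "Fd G \<noteq> {}"
      using opt[OF that] X finite_subset[of "Fd G" "mat_apply d m G ` X"]
      by (auto simp: fl_optimal_def fl_solution_def)
  qed
  show int: "integrable ?M (\<lambda>G. fl_cost d (mat_apply d m G ` X) (Fd G))"
  proof (rule Bochner_Integration.integrable_bound[OF b_int fl_cost_optimum_measurable[OF X opt]])
    show "AE G in ?M. norm (fl_cost d (mat_apply d m G ` X) (Fd G)) \<le> norm (?b G)"
    proof (rule AE_I2)
      fix G assume "G \<in> space ?M"
      then show "norm (fl_cost d (mat_apply d m G ` X) (Fd G)) \<le> norm (?b G)"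
        using le[of G] nonneg[of G] unfolding real_norm_def by linarith
    qed
  qed
  have "(\<integral>G. fl_cost d (mat_apply d m G ` X) (Fd G) \<partial>?M) \<le> (\<integral>G. ?b G \<partial>?M)"
    using le by (intro integral_mono int b_int) auto
  then show "(\<integral>G. fl_cost d (mat_apply d m G ` X) (Fd G) \<partial>?M) \<le> fl_cost m X F"
    by (simp only: b_eq)
qed

text \<open>The constant is \<open>8 * 2 * 2 ^ 22 * 4\<close>: the greedy solution, the probability
  \<open>1 / 2\<close>, the shrinking of squared radii by \<open>2 ^ 22\<close>, and the charging to
  a projected solution.\<close>

lemma expected_fl_cost_lower:
  assumes X: "finite X" "X \<noteq> {}" "X \<subseteq> topspace (Euclidean_space m)"
    and d: "1 \<le> d" "40 * ln (real (doubling_constant m X)) \<le> real d"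
    and Fm: "fl_optimal m X Fm"
    and opt: "\<And>G. G \<in> space (gaussian_matrix d m) \<Longrightarrow> fl_optimal d (mat_apply d m G ` X) (Fd G)"
  shows "fl_cost m X Fm \<le> 2 ^ 28 * (\<integral>G. fl_cost d (mat_apply d m G ` X) (Fd G) \<partial>gaussian_matrix d m)"
proof -
  let ?M = "gaussian_matrix d m"
  let ?g = "mat_apply d m"
  interpret prob_space ?M
    by (rule prob_space_gaussian_matrix[OF d(1)])
  interpret Em: Metric_space "topspace (Euclidean_space m)" "edist m"
    by (rule Metric_space_edist)
  interpret Ed: Metric_space "topspace (Euclidean_space d)" "edist d"
    by (rule Metric_space_edist)
  have "\<forall>p\<in>X. \<exists>r. 0 < r \<and> 1 \<le> r\<^sup>2 * real (card {q\<in>X. edist m p q \<le> r}) \<and>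
      r\<^sup>2 * real (card {q\<in>X. edist m p q < r}) \<le> 1"
  proof
    fix p assume p: "p \<in> X"
    then have "p \<in> topspace (Euclidean_space m)"
      using X(3) by blast
    from Em.critical_radius_exists[OF X(1) p this]
    show "\<exists>r. 0 < r \<and> 1 \<le> r\<^sup>2 * real (card {q\<in>X. edist m p q \<le> r}) \<and>
        r\<^sup>2 * real (card {q\<in>X. edist m p q < r}) \<le> 1"
      by blast
  qed
  from bchoice[OF this] obtain r where r_pos: "\<And>p. p \<in> X \<Longrightarrow> 0 < r p"
    and r_ball: "\<And>p. p \<in> X \<Longrightarrow> 1 \<le> (r p)\<^sup>2 * real (card {q\<in>X. edist m p q \<le> r p})"
    and r_open: "\<And>p. p \<in> X \<Longrightarrow> (r p)\<^sup>2 * real (card {q\<in>X. edist m p q < r p}) \<le> 1"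
    by blast
  define bad where "bad p = {G\<in>space ?M.
      \<exists>q\<in>X. r p \<le> edist m p q \<and> edist d (?g G p) (?g G q) < r p / 2 ^ 11}" for p
  define good where "good p = space ?M - bad p" for p
  have bad_sets: "bad p \<in> sets ?M" for p
    unfolding bad_def using X(1) by measurable
  then have good_sets: "good p \<in> sets ?M" for p
    by (simp add: good_def sets.compl_sets)
  have good_prob: "1 / 2 \<le> prob (good p)" if "p \<in> X" for p
    using far_points_stay_far[OF X(1,3) that r_pos[OF that] d] prob_compl[OF bad_sets[of p]]
    by (simp add: good_def bad_def)
  let ?H = "\<lambda>G. fl_cost d (?g G ` X) (Fd G)"
  \<comment> \<open>Only the points that are good for the given matrix are charged. Linearity of
    expectation later recovers at least half of the full sum.\<close>
  let ?L = "\<lambda>G. \<Sum>p\<in>X. (r p / 2 ^ 11)\<^sup>2 * indicator (good p) G"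
  have le: "?L G \<le> 4 * ?H G" if G: "G \<in> space ?M" and inj: "inj_on (?g G) X" for G
  proof -
    let ?P = "{p\<in>X. G \<in> good p}"
    have F: "Fd G \<subseteq> ?g G ` X" "Fd G \<noteq> {}"
      using opt[OF G] by (auto simp: fl_optimal_def fl_solution_def)
    have "?L G = (\<Sum>p\<in>X. if G \<in> good p then (r p / 2 ^ 11)\<^sup>2 else 0)"
      by (intro sum.cong) (auto simp: indicator_def)
    also have "\<dots> = (\<Sum>p\<in>?P. (r p / 2 ^ 11)\<^sup>2)"
      using X(1) by (rule sum.inter_filter[symmetric])
    also have "\<dots> \<le> real (card (Fd G)) + 4 * (\<Sum>x\<in>X. Min ((\<lambda>f. (edist d (?g G x) f)\<^sup>2) ` Fd G))"
    proof (rule Ed.sum_radii_le_facility_cost)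
      show "finite (Fd G)" "Fd G \<subseteq> topspace (Euclidean_space d)"
        using F(1) X(1) by (auto intro: finite_subset)
    next
      fix p assume p: "p \<in> ?P"
      then have "r p / 2 ^ 11 \<le> edist d (?g G p) (?g G q)" if "q \<in> X" "r p \<le> edist m p q" for q
        using that G by (auto simp: good_def bad_def not_less)
      then have "{q\<in>X. edist d (?g G p) (?g G q) < r p / 2 ^ 11} \<subseteq> {q\<in>X. edist m p q < r p}"
        by (force simp: not_le[symmetric])
      then have "card {q\<in>X. edist d (?g G p) (?g G q) < r p / 2 ^ 11} \<le> card {q\<in>X. edist m p q < r p}"
        using X(1) by (intro card_mono) auto
      moreover have "(r p / 2 ^ 11)\<^sup>2 \<le> (r p)\<^sup>2"
        using r_pos[of p] p by (intro power_mono) auto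
      ultimately have "(r p / 2 ^ 11)\<^sup>2 * real (card {q\<in>X. edist d (?g G p) (?g G q) < r p / 2 ^ 11})
          \<le> (r p)\<^sup>2 * real (card {q\<in>X. edist m p q < r p})"
        by (intro mult_mono) auto
      also have "\<dots> \<le> 1"
        using r_open p by blast
      finally show "(r p / 2 ^ 11)\<^sup>2 * real (card {q\<in>X. edist d (?g G p) (?g G q) < r p / 2 ^ 11}) \<le> 1" .
    qed (use X F r_pos in auto)
    \<comment> \<open>The charging argument sums over \<open>X\<close>, the projected cost over the
      image set. Injectivity identifies them, which is why the comparison holds only almost
      everywhere.\<close>
    also have "(\<Sum>x\<in>X. Min ((\<lambda>f. (edist d (?g G x) f)\<^sup>2) ` Fd G))
        = (\<Sum>y\<in>?g G ` X. Min ((\<lambda>f. (edist d y f)\<^sup>2) ` Fd G))"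
      using inj by (simp add: sum.reindex)
    finally show ?thesis
      by (simp add: fl_cost_def)
  qed
  have L_int: "integrable ?M ?L"
    using good_sets by (intro Bochner_Integration.integrable_sum integrable_mult_right) (simp add: integrable_real_indicator less_top[symmetric])
  have H_int: "integrable ?M ?H"
    using Fm by (intro expected_fl_cost_upper[OF X(1,2) d(1) _ opt]) (auto simp: fl_optimal_def)
  obtain F where F: "F \<subseteq> X" "F \<noteq> {}"
    "real (card F) + (\<Sum>x\<in>X. Min ((\<lambda>f. (edist m x f)\<^sup>2) ` F)) \<le> 8 * (\<Sum>p\<in>X. (r p)\<^sup>2)"
    using Em.facility_cost_le_sum_radii[OF X r_pos r_ball] .
  have "fl_cost m X Fm \<le> fl_cost m X F"
    using Fm F by (simp add: fl_optimal_def fl_solution_def)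
  also have "\<dots> \<le> 8 * (\<Sum>p\<in>X. (r p)\<^sup>2)"
    using F by (simp add: fl_cost_def)
  also have "\<dots> = 2 ^ 26 * (\<Sum>p\<in>X. (r p / 2 ^ 11)\<^sup>2 * (1 / 2))"
    by (simp add: power_divide sum_distrib_left)
  also have "\<dots> \<le> 2 ^ 26 * (\<Sum>p\<in>X. (r p / 2 ^ 11)\<^sup>2 * prob (good p))"
    using good_prob by (intro mult_left_mono sum_mono) auto
  also have "(\<Sum>p\<in>X. (r p / 2 ^ 11)\<^sup>2 * prob (good p)) = (\<integral>G. ?L G \<partial>?M)"
    using good_sets by (subst Bochner_Integration.integral_sum) (auto simp: less_top[symmetric] sets.Int_space_eq2)
  also have "2 ^ 26 * (\<integral>G. ?L G \<partial>?M) \<le> 2 ^ 26 * (\<integral>G. 4 * ?H G \<partial>?M)"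
  proof (intro mult_left_mono integral_mono_AE L_int integrable_mult_right H_int)
    show "AE G in ?M. ?L G \<le> 4 * ?H G"
      using AE_space AE_inj_on_mat_apply[OF X(1,3) d(1)] by eventually_elim (rule le)
  qed simp
  also have "\<dots> = 2 ^ 28 * (\<integral>G. ?H G \<partial>?M)"
    by simp
  finally show ?thesis .
qed

theorem theoremF4:
  shows "\<exists>C0>0::real. \<exists>c>0::real. \<exists>C>0::real.
    \<forall>(m::nat) (d::nat) (X :: (nat \<Rightarrow> real) set) (Fm :: (nat \<Rightarrow> real) set)
      (Fd :: (nat \<times> nat \<Rightarrow> real) \<Rightarrow> (nat \<Rightarrow> real) set).
      X \<subseteq> topspace (Euclidean_space m) \<longrightarrow> finite X \<longrightarrow> X \<noteq> {} \<longrightarrow>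
      d \<ge> 1 \<longrightarrow> real d \<ge> C0 * ln (real (doubling_constant m X)) \<longrightarrow>
      fl_optimal m X Fm \<longrightarrow>
      (\<forall>G\<in>space (gaussian_matrix d m). fl_optimal d (mat_apply d m G ` X) (Fd G)) \<longrightarrow>
      c * fl_cost m X Fm
        \<le> (\<integral>G. fl_cost d (mat_apply d m G ` X) (Fd G) \<partial>gaussian_matrix d m) \<and>
      (\<integral>G. fl_cost d (mat_apply d m G ` X) (Fd G) \<partial>gaussian_matrix d m)
        \<le> C * fl_cost m X Fm"
proof (rule exI[of _ 40], rule conjI, simp, rule exI[of _ "1 / 2 ^ 28"], rule conjI, simp,
    rule exI[of _ 1], rule conjI, simp, intro allI impI)
  fix m d :: nat and X Fm :: "(nat \<Rightarrow> real) set" and Fd :: "(nat \<times> nat \<Rightarrow> real) \<Rightarrow> (nat \<Rightarrow> real) set"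
  let ?E = "\<integral>G. fl_cost d (mat_apply d m G ` X) (Fd G) \<partial>gaussian_matrix d m"
  assume X: "X \<subseteq> topspace (Euclidean_space m)" "finite X" "X \<noteq> {}"
    and d: "1 \<le> d" "40 * ln (real (doubling_constant m X)) \<le> real d"
    and Fm: "fl_optimal m X Fm"
    and Fd: "\<forall>G\<in>space (gaussian_matrix d m). fl_optimal d (mat_apply d m G ` X) (Fd G)"
  have "fl_cost m X Fm \<le> 2 ^ 28 * ?E"
    using Fd by (intro expected_fl_cost_lower X d Fm) blast
  \<comment> \<open>The upper constant can be 1, since the image of \<open>Fm\<close> competes with
    the optimum for every matrix.\<close>
  moreover have "?E \<le> fl_cost m X Fm"
    using Fm Fd by (intro expected_fl_cost_upper X d) (auto simp: fl_optimal_def)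
  ultimately show "1 / 2 ^ 28 * fl_cost m X Fm \<le> ?E \<and> ?E \<le> 1 * fl_cost m X Fm"
    by simp
qed

end
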